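(* Let $W$ be the Coxeter group of type $B_n$ and $\hat W$ its canonical index 2 subgroup of type $D_n$. Let $C$ be a conjugacy class of $W$ and $w\in C$. Let $w_0$ be the longest element of $W$ and let $C_0$ be the conjugacy class of $ww_0$ in $W$. Then: (1) the maximal $B$-length of elements of $C$ is $n^2-|\Lambda(u_{C_0})|-|\Sigma(u_{C_0})|$, and $u_{C_0}w_0$ is an element of $C$ of maximal $B$-length; (2) if $C$ is a conjugacy class or a union of conjugacy classes of $\hat W$, then the maximal $D$-length of elements of $C$ is $n^2-n-|\Lambda(u_{C_0})|$. Moreover $u_{C_0}w_0$ and $u_{C_0}^{t}w_0$ are representatives of maximal $D$-length in the $\hat W$-class(es) contained in $C$, with one in each $\hat W$-class if $C$ is a split class (i.e. if $C$ is the union of two $\hat W$-conjugacy classes).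
   Context: $W$ is the group of signed permutations, i.e. the linear maps of $\mathbb{R}^n$ (acting on the left) permuting $\{\pm e_1,\dots,\pm e_n\}$; $\hat W$ is the subgroup of elements with an even number of sign changes; $w_0=-1$. Elements are written as products of disjoint signed cycles (including 1-cycles): if $j$ follows $i$ cyclically, then $e_i\mapsto e_j$ if the entry is $\overset{+}{i}$ and $e_i\mapsto -e_j$ if the entry is $\overset{-}{i}$. A cycle is negative if it has an odd number of minus signs, and positive otherwise. Conjugacy classes of $W$ are parameterized by signed cycle type $\lambda(C)=(\lambda_1,\dots,\lambda_{\nu_C};\lambda_{\nu_C+1},\dots,\lambda_{z_C})$, where $\nu_C$ is the number of negative cycles, $z_C$ the total number of cycles, $\lambda_1\le\cdots\le\lambda_{\nu_C}$ the lengths of the negative cycles and $\lambda_{\nu_C+1}\le\cdots\le\lambda_{z_C}$ the lengths of the positive cycles. $\Phi_{\mathrm{long}}^+=\{e_i\pm e_j:1\le i<j\le n\}$, $\Phi_{\mathrm{short}}^+=\{e_i:1\le i\le n\}$, $\Phi^+=\Phi_{\mathrm{long}}^+\cup\Phi_{\mathrm{short}}^+$, $\Phi^-=-\Phi^+$. For $w\in W$, $\Lambda(w)=\{\alpha\in\Phi_{\mathrm{long}}^+:w(\alpha)\in\Phi^-\}$ and $\Sigma(w)=\{\alpha\in\Phi_{\mathrm{short}}^+:w(\alpha)\in\Phi^-\}$. The $B$-length is $l_B(w)=|\Lambda(w)|+|\Sigma(w)|$ and the $D$-length is $l_D(w)=|\Lambda(w)|$. For a conjugacy class $C$ of $W$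 with $\nu=\nu_C$, $z=z_C$, put $\mu_i=n-\sum_{j=1}^i\lambda_j$ for $0\le i\le z$ (so $\mu_0=n$, $\mu_z=0$). The element $u_C\in C$ is the product of the $z$ disjoint signed cycles $c_1,\dots,c_z$, where $c_i=(\overset{+}{\mu_i+1},\overset{+}{\mu_i+2},\dots,\overset{+}{\mu_{i-1}-1},\overset{-}{\mu_{i-1}})$ for $1\le i\le\nu$ and $c_i=(\overset{+}{\mu_i+1},\overset{+}{\mu_i+2},\dots,\overset{+}{\mu_{i-1}})$ for $\nu<i\le z$. Finally $t=(\overset{-}{n})$ (the map negating $e_n$ and fixing the other $e_i$), and $u_C^t=t^{-1}u_Ct$. *)

theory Defs
  imports "HOL-Analysis.Analysis" "HOL-Algebra.Group"
begin

section \<open>Groups and conjugacy classes\<close>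

definition conj_class :: "('a, 'b) monoid_scheme \<Rightarrow> 'a \<Rightarrow> 'a set" where
  "conj_class G x = {g \<otimes>\<^bsub>G\<^esub> x \<otimes>\<^bsub>G\<^esub> inv\<^bsub>G\<^esub> g | g. g \<in> carrier G}"

definition conj_classes :: "('a, 'b) monoid_scheme \<Rightarrow> 'a set set" where
  "conj_classes G = conj_class G ` carrier G"


section \<open>Signed permutations\<close>

text \<open>
  The space is \<^typ>\<open>real ^ 'n\<close> with \<open>n = CARD('n)\<close>. The linear order on the index type serves only
  to number the standard basis vectors; the numbering \<open>e\<^sub>1, \<dots>, e\<^sub>n\<close> starts at \<open>1\<close>, and
  \<open>evec i\<close> has no meaning for \<open>i\<close> outside \<open>{1..n}\<close>.
\<close>

type_synonym 'n endo = "(real, 'n) vec \<Rightarrow> (real, 'n) vec"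

definition evec :: "nat \<Rightarrow> (real, 'n::{finite,linorder}) vec" where
  "evec i = axis (sorted_list_of_set (UNIV :: 'n set) ! (i - 1)) 1"

definition signed_basis :: "(real, 'n::{finite,linorder}) vec set" where
  "signed_basis = {evec i | i. i \<in> {1..CARD('n)}} \<union> {- evec i | i. i \<in> {1..CARD('n)}}"

definition W :: "('n::{finite,linorder}) endo monoid" where
  "W = \<lparr>carrier = {f. linear f \<and> f ` signed_basis = signed_basis}, mult = (\<circ>), one = id\<rparr>"

definition sign_changes :: "('n::{finite,linorder}) endo \<Rightarrow> nat" where
  "sign_changes w = card {i \<in> {1..CARD('n)}. \<exists>j \<in> {1..CARD('n)}. w (evec i) = - evec j}"

definition W_hat :: "('n::{finite,linorder}) endo monoid" where
  "W_hat = W\<lparr>carrier := {w \<in> carrier W. even (sign_changes w)}\<rparr>"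

definition w0 :: "('n::{finite,linorder}) endo" where
  "w0 = (\<lambda>x. - x)"


section \<open>Roots and lengths\<close>

definition Phi_long_pos :: "(real, 'n::{finite,linorder}) vec set" where
  "Phi_long_pos = {evec i + evec j | i j. 1 \<le> i \<and> i < j \<and> j \<le> CARD('n)}
                \<union> {evec i - evec j | i j. 1 \<le> i \<and> i < j \<and> j \<le> CARD('n)}"

definition Phi_short_pos :: "(real, 'n::{finite,linorder}) vec set" where
  "Phi_short_pos = {evec i | i. 1 \<le> i \<and> i \<le> CARD('n)}"

definition Phi_pos :: "(real, 'n::{finite,linorder}) vec set" where
  "Phi_pos = Phi_long_pos \<union> Phi_short_pos"

definition Phi_neg :: "(real, 'n::{finite,linorder}) vec set" where
  "Phi_neg = uminus ` Phi_pos"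

definition Lambda :: "('n::{finite,linorder}) endo \<Rightarrow> (real, 'n) vec set" where
  "Lambda w = {\<alpha> \<in> Phi_long_pos. w \<alpha> \<in> Phi_neg}"

definition Sigma_short :: "('n::{finite,linorder}) endo \<Rightarrow> (real, 'n) vec set" where
  "Sigma_short w = {\<alpha> \<in> Phi_short_pos. w \<alpha> \<in> Phi_neg}"

definition l_B :: "('n::{finite,linorder}) endo \<Rightarrow> nat" where
  "l_B w = card (Lambda w) + card (Sigma_short w)"

definition l_D :: "('n::{finite,linorder}) endo \<Rightarrow> nat" where
  "l_D w = card (Lambda w)"


section \<open>Signed cycles\<close>

text \<open>
  A signed cycle is written as a list of nonzero integers: the entry \<open>k\<close> stands for the index
  \<open>\<bar>k\<bar>\<close> carrying the sign of \<open>k\<close>.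
\<close>

abbreviation idx :: "int \<Rightarrow> nat" where
  "idx k \<equiv> nat \<bar>k\<bar>"

definition is_signed_cycle :: "nat \<Rightarrow> int list \<Rightarrow> bool" where
  "is_signed_cycle n c \<longleftrightarrow> c \<noteq> [] \<and> distinct (map idx c) \<and> idx ` set c \<subseteq> {1..n}"

definition negative_cycle :: "int list \<Rightarrow> bool" where
  "negative_cycle c \<longleftrightarrow> odd (length (filter (\<lambda>k. k < 0) c))"

text \<open>
  The sign sits on the source: an entry \<open>k\<close> followed cyclically by \<open>k'\<close> sends \<open>e\<close> with index
  \<open>\<bar>k\<bar>\<close> to \<open>sgn k\<close> times \<open>e\<close> with index \<open>\<bar>k'\<bar>\<close>. The formula is the linear map doing this and
  fixing the other basis vectors, see \<open>cycle_map_entry\<close> and \<open>cycle_map_other\<close> below.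
\<close>

definition cycle_map :: "int list \<Rightarrow> ('n::{finite,linorder}) endo" where
  "cycle_map c x = x + (\<Sum>k<length c. (x \<bullet> evec (idx (c ! k))) *\<^sub>R
     (of_int (sgn (c ! k)) *\<^sub>R evec (idx (c ! (Suc k mod length c))) - evec (idx (c ! k))))"

definition cycle_product :: "int list list \<Rightarrow> ('n::{finite,linorder}) endo" where
  "cycle_product cs = foldr (\<circ>) (map cycle_map cs) id"

text \<open>Cycles of length one are included, so every index occurs exactly once.\<close>

definition is_cycle_decomposition ::
    "('n::{finite,linorder}) endo \<Rightarrow> int list list \<Rightarrow> bool" where
  "is_cycle_decomposition w cs \<longleftrightarrow>
     (\<forall>c \<in> set cs. is_signed_cycle CARD('n) c) \<and>
     distinct (map idx (concat cs)) \<and> idx ` set (concat cs) = {1..CARD('n)} \<and>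
     w = cycle_product cs"

text \<open>
  The lengths of the negative and of the positive cycles, each in increasing order. This depends
  only on the conjugacy class, neither on the element nor on the decomposition.
\<close>

definition signed_cycle_type ::
    "('n::{finite,linorder}) endo set \<Rightarrow> nat list \<times> nat list" where
  "signed_cycle_type C = (THE (neg, pos). \<exists>w \<in> C. \<exists>cs. is_cycle_decomposition w cs \<and>
     neg = sort (map length (filter negative_cycle cs)) \<and>
     pos = sort (map length (filter (\<lambda>c. \<not> negative_cycle c) cs)))"


section \<open>The elements $u_C$ and $t$\<close>

text \<open>
  The list \<open>cyc_lengths C\<close> is \<open>\<lambda>\<^sub>1, \<dots>, \<lambda>\<^sub>z\<close>, with the negative cycles first; list positions start
  at \<open>0\<close>, hence \<open>mu C i\<close> subtracts its first \<open>i\<close> members.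
\<close>

definition cyc_lengths :: "('n::{finite,linorder}) endo set \<Rightarrow> nat list" where
  "cyc_lengths C = fst (signed_cycle_type C) @ snd (signed_cycle_type C)"

definition nu :: "('n::{finite,linorder}) endo set \<Rightarrow> nat" where
  "nu C = length (fst (signed_cycle_type C))"

definition mu :: "('n::{finite,linorder}) endo set \<Rightarrow> nat \<Rightarrow> nat" where
  "mu C i = CARD('n) - sum_list (take i (cyc_lengths C))"

definition u_cycle :: "('n::{finite,linorder}) endo set \<Rightarrow> nat \<Rightarrow> int list" where
  "u_cycle C i = map int [mu C i + 1 ..< mu C (i - 1)] @
     [if i \<le> nu C then - int (mu C (i - 1)) else int (mu C (i - 1))]"

definition u :: "('n::{finite,linorder}) endo set \<Rightarrow> 'n endo" where
  "u C = cycle_product (map (u_cycle C) [1 ..< length (cyc_lengths C) + 1])"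

definition t :: "('n::{finite,linorder}) endo" where
  "t = cycle_map [- int CARD('n)]"


section \<open>Basic facts\<close>

lemma evec_inner:
  assumes "i \<in> {1..CARD('n)}" "j \<in> {1..CARD('n)}"
  shows "(evec i :: (real, 'n::{finite,linorder}) vec) \<bullet> evec j = (if i = j then 1 else 0)"
proof -
  let ?l = "sorted_list_of_set (UNIV :: 'n set)"
  have "?l ! (i - 1) = ?l ! (j - 1) \<longleftrightarrow> i = j"
    using assms by (subst nth_eq_iff_index_eq) auto
  then show ?thesis
    by (simp add: evec_def inner_axis_axis)
qed

lemma linear_cycle_map: "linear (cycle_map c)"
  by (rule linearI)
    (simp_all add: cycle_map_def inner_add_left scaleR_add_left sum.distrib scaleR_add_right
      scaleR_sum_right)

lemma cycle_map_entry:
  assumes c: "is_signed_cycle CARD('n) c" and m: "m < length c"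
  shows "cycle_map c (evec (idx (c ! m)) :: (real, 'n::{finite,linorder}) vec) =
    of_int (sgn (c ! m)) *\<^sub>R evec (idx (c ! (Suc m mod length c)))"
proof -
  have rng: "idx (c ! k) \<in> {1..CARD('n)}" if "k < length c" for k
    using c that unfolding is_signed_cycle_def by (meson image_subset_iff nth_mem)
  have inj: "idx (c ! m) = idx (c ! k) \<longleftrightarrow> k = m" if "k < length c" for k
    using c that m nth_eq_iff_index_eq[of "map idx c" m k] unfolding is_signed_cycle_def by auto
  let ?g = "\<lambda>k. of_int (sgn (c ! k)) *\<^sub>R evec (idx (c ! (Suc k mod length c)))
      - evec (idx (c ! k)) :: (real, 'n) vec"
  have "(\<Sum>k<length c. ((evec (idx (c ! m)) :: (real, 'n) vec) \<bullet> evec (idx (c ! k))) *\<^sub>R ?g k) =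
      (\<Sum>k<length c. if k = m then ?g k else 0)"
    by (rule sum.cong[OF refl]) (use rng[OF m] rng inj in \<open>simp add: evec_inner\<close>)
  also have "\<dots> = ?g m" using m by simp
  finally show ?thesis by (simp add: cycle_map_def)
qed

lemma cycle_map_other:
  assumes c: "is_signed_cycle CARD('n) c" and i: "i \<in> {1..CARD('n)}" "i \<notin> idx ` set c"
  shows "cycle_map c (evec i :: (real, 'n::{finite,linorder}) vec) = evec i"
proof -
  have "(evec i :: (real, 'n) vec) \<bullet> evec (idx (c ! k)) = 0" if "k < length c" for k
  proof -
    have "idx (c ! k) \<in> idx ` set c" using that by simp
    moreover from this have "idx (c ! k) \<in> {1..CARD('n)}"
      using c unfolding is_signed_cycle_def by blast
    ultimately show ?thesis using i evec_inner[of i "idx (c ! k)"] by metis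
  qed
  then show ?thesis by (simp add: cycle_map_def)
qed

end

theory Submission
  imports Defs "HOL-Combinatorics.Cycles"
begin

text \<open>
  Multiplication by \<open>w\<^sub>0 = - 1\<close> complements inversion sets, so the theorem says that \<open>u\<^sub>C\<close> minimises
  both \<open>\<bar>\<Lambda>\<bar>\<close> and \<open>\<bar>\<Sigma>\<bar>\<close> on its class. An element of the class splits the signed basis vectors into
  one orbit per cycle (closed under negation), and twice \<open>\<bar>\<Lambda>\<bar>\<close> is the number of ordered pairs of
  non-proportional signed basis vectors whose sum is positive and becomes negative. Such pairs are
  found by following a pair along the iterates of \<open>w\<close>: inside an orbit of a cycle of length \<open>\<lambda>\<close>, the values along the
  iterates sum to zero, which forces \<open>2 (\<lambda> - 1)\<close> descents; for two negative cycles of lengths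
  \<open>\<lambda>\<close> and \<open>\<lambda>'\<close>, a vector of maximal height in their union is carried to its negative,
  which forces \<open>2 min \<lambda> \<lambda>'\<close> descents. The element \<open>u\<^sub>C\<close> attains the sum of these bounds.
  In the split case, \<open>W\<close> is the union of the type \<open>D\<close> subgroup and its coset by \<open>t\<close>.
\<close>

section \<open>Signed basis vectors and roots\<close>

text \<open>Ordered pairs of vectors are counted instead of roots because \<open>w\<close> acts on
  each component separately, so the count splits along pairs of orbits; the price is a factor 2. The
  obstacle is that the same inversion may be met from several starting pairs. Counting descents
  bounds the number of inversions only once different starting pairs are known to lead to different
  inversions, so every lower bound carries an injectivity argument.

  No cross term is claimed for a pair of cycles one of which is positive. In \<open>u C\<close> the
  positive cycles occupy the smallest indices, where a mixed pair produces no inversion. Among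
  negative cycles the increasing order of lengths puts the longer ones on smaller indices, that is,
  at greater height; each cross term is then governed by the shorter length, which is the minimum in
  the lower bound.

  All bounds depend on cycle lengths and signs alone. They are proved for an abstract system of
  orbits that can be carried along a conjugation, so one decomposition of one element serves the
  whole class.\<close>

lemma evec_image_Basis: "evec ` {1..CARD('n)} = (Basis :: (real, 'n::{finite,linorder}) vec set)"
proof -
  let ?l = "sorted_list_of_set (UNIV :: 'n set)"
  have len: "length ?l = CARD('n)" by simp
  have "(\<lambda>i. ?l ! (i - 1)) ` {1..CARD('n)} = set ?l"
  proof (intro equalityI subsetI)
    fix x assume "x \<in> set ?l"
    then obtain i where "i < length ?l" "x = ?l ! i" by (metis in_set_conv_nth)
    then show "x \<in> (\<lambda>i. ?l ! (i - 1)) ` {1..CARD('n)}"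
      using len by (intro image_eqI[of _ _ "Suc i"]) auto
  qed simp
  then have "(\<lambda>i. ?l ! (i - 1)) ` {1..CARD('n)} = UNIV" by simp
  then have "range (\<lambda>k. axis k (1::real)) = (evec ` {1..CARD('n)} :: (real, 'n) vec set)"
    using image_image[of "\<lambda>k. axis k (1::real)" "\<lambda>i. ?l ! (i - 1)" "{1..CARD('n)}"]
    by (simp add: evec_def[abs_def])
  then show ?thesis
    by (auto simp: Basis_vec_def)
qed

lemma evec_in_Basis: "i \<in> {1..CARD('n)} \<Longrightarrow> evec i \<in> (Basis :: (real, 'n::{finite,linorder}) vec set)"
  using evec_image_Basis by blast

lemma evec_eq_iff:
  assumes "i \<in> {1..CARD('n)}" "j \<in> {1..CARD('n)}"
  shows "(evec i :: (real, 'n::{finite,linorder}) vec) = evec j \<longleftrightarrow> i = j"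
  using evec_inner[OF assms] evec_inner[OF assms(1,1)] by (auto split: if_splits)

lemma inj_on_evec: "inj_on (evec :: nat \<Rightarrow> (real, 'n::{finite,linorder}) vec) {1..CARD('n)}"
  by (auto simp: inj_on_def evec_eq_iff)

lemma linear_eq_evec:
  fixes f g :: "('n::{finite,linorder}) endo"
  assumes "linear f" "linear g" "\<And>i. i \<in> {1..CARD('n)} \<Longrightarrow> f (evec i) = g (evec i)"
  shows "f = g"
proof (rule linear_eq_stdbasis[OF assms(1,2)])
  fix b :: "(real, 'n) vec" assume "b \<in> Basis"
  then obtain i where "i \<in> {1..CARD('n)}" "b = evec i" using evec_image_Basis[where 'n='n] by blast
  then show "f b = g b" using assms(3) by simp
qed

lemma signed_basis_eq: "signed_basis = Basis \<union> uminus ` (Basis :: (real, 'n::{finite,linorder}) vec set)"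
  unfolding signed_basis_def evec_image_Basis[symmetric] by auto

lemma finite_signed_basis: "finite (signed_basis :: (real, 'n::{finite,linorder}) vec set)"
  by (simp add: signed_basis_eq)

lemma uminus_signed_basis [simp]: "- v \<in> signed_basis \<longleftrightarrow> (v :: (real, 'n::{finite,linorder}) vec) \<in> signed_basis"
  by (force simp: signed_basis_eq)

lemma evec_signed_basis: "i \<in> {1..CARD('n)} \<Longrightarrow> evec i \<in> (signed_basis :: (real, 'n::{finite,linorder}) vec set)"
  by (simp add: signed_basis_eq evec_in_Basis)

lemma signed_basisE:
  assumes "v \<in> (signed_basis :: (real, 'n::{finite,linorder}) vec set)"
  obtains i where "i \<in> {1..CARD('n)}" "v = evec i" | i where "i \<in> {1..CARD('n)}" "v = - evec i"
  using assms unfolding signed_basis_def by blast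

lemma signed_basis_inner:
  assumes "v \<in> signed_basis" "v' \<in> (signed_basis :: (real, 'n::{finite,linorder}) vec set)"
  shows "v \<bullet> v' = (if v = v' then 1 else if v = - v' then - 1 else 0)"
proof -
  have Z: "b \<noteq> - b'" if "b \<in> Basis" "b' \<in> Basis" for b b' :: "(real, 'n) vec"
  proof
    assume "b = - b'"
    then have "b \<bullet> b' = - 1" using that by (simp add: inner_Basis)
    then show False using that by (simp add: inner_Basis split: if_splits)
  qed
  obtain b b' where b: "b \<in> Basis" "b' \<in> Basis" and v: "v = b \<or> v = - b" "v' = b' \<or> v' = - b'"
    using assms unfolding signed_basis_eq by auto
  have "b \<noteq> - b'" "- b \<noteq> b'" using Z[OF b] Z[OF b(2,1)] by auto
  with v show ?thesis
    by (elim disjE) (simp_all add: inner_Basis[OF b])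
qed

lemma signed_basis_nz: "v \<in> (signed_basis :: (real, 'n::{finite,linorder}) vec set) \<Longrightarrow> v \<noteq> 0"
  using signed_basis_inner[of v v] by auto

lemma signed_basis_neq_minus: "v \<in> (signed_basis :: (real, 'n::{finite,linorder}) vec set) \<Longrightarrow> v \<noteq> - v"
  using signed_basis_nz by (auto simp: eq_neg_iff_add_eq_0 vec_eq_iff)

lemma linear_eq_signed_basis:
  fixes f g :: "('n::{finite,linorder}) endo"
  assumes "linear f" "linear g" "\<And>v. v \<in> signed_basis \<Longrightarrow> f v = g v"
  shows "f = g"
  using assms(3) by (intro linear_eq_evec[OF assms(1,2)]) (simp add: evec_signed_basis)

text \<open>A root is positive iff its value under \<open>rho\<close> is.\<close>

definition rho :: "(real, 'n::{finite,linorder}) vec \<Rightarrow> real" where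
  "rho v = (\<Sum>i = 1..CARD('n). real (CARD('n) + 1 - i) * (v \<bullet> evec i))"

lemma linear_rho: "linear rho"
  by (rule linearI)
    (simp_all add: rho_def inner_add_left distrib_left sum.distrib sum_distrib_left mult.left_commute)

lemmas rho_add = linear_add[OF linear_rho] and rho_minus = linear_neg[OF linear_rho]
  and rho_diff = linear_diff[OF linear_rho] and rho_sum = linear_sum[OF linear_rho]
  and rho_scale = linear_scale[OF linear_rho]

lemma rho_evec:
  assumes "i \<in> {1..CARD('n)}"
  shows "rho (evec i :: (real, 'n::{finite,linorder}) vec) = real (CARD('n) + 1 - i)"
proof -
  have "rho (evec i :: (real, 'n) vec) = (\<Sum>j = 1..CARD('n). if i = j then real (CARD('n) + 1 - j) else 0)"
    unfolding rho_def by (rule sum.cong[OF refl]) (use assms in \<open>simp add: evec_inner\<close>)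
  then show ?thesis using assms by simp
qed

lemma rho_evec_pos: "i \<in> {1..CARD('n)} \<Longrightarrow> rho (evec i :: (real, 'n::{finite,linorder}) vec) > 0"
  by (simp add: rho_evec)

lemma rho_nz: "v \<in> (signed_basis :: (real, 'n::{finite,linorder}) vec set) \<Longrightarrow> rho v \<noteq> 0"
  by (erule signed_basisE) (auto simp: rho_minus rho_evec)

text \<open>The heights of the signed basis vectors are n, ..., 1 and their negatives, all distinct.
  Hence two vectors that are not opposite have a sum of nonzero height, and two disjoint orbits can
  be compared by their highest vectors.\<close>

lemma rho_inj:
  assumes "v \<in> signed_basis" "v' \<in> (signed_basis :: (real, 'n::{finite,linorder}) vec set)" "rho v = rho v'"
  shows "v = v'"
  using assms by (auto elim!: signed_basisE simp: rho_minus rho_evec of_nat_diff)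

lemma rho_add_nz:
  assumes "v \<in> signed_basis" "v' \<in> (signed_basis :: (real, 'n::{finite,linorder}) vec set)" "v' \<noteq> - v"
  shows "rho (v + v') \<noteq> 0"
  using rho_inj[of v' "- v"] assms by (auto simp: rho_add rho_minus)

lemma rho_pos_evec:
  assumes "v \<in> (signed_basis :: (real, 'n::{finite,linorder}) vec set)" "rho v > 0"
  obtains i where "i \<in> {1..CARD('n)}" "v = evec i"
  using assms by (auto elim!: signed_basisE simp: rho_minus rho_evec)

text \<open>One description for both signs of the long roots: the condition
  \<open>v' \<noteq> v\<close> removes twice a basis vector, the condition
  \<open>v' \<noteq> - v\<close> removes 0.\<close>

definition long_roots :: "(real, 'n::{finite,linorder}) vec set" where
  "long_roots = {v + v' | v v'. v \<in> signed_basis \<and> v' \<in> signed_basis \<and> v' \<noteq> v \<and> v' \<noteq> - v}"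

lemma uminus_long_roots [simp]: "- a \<in> long_roots \<longleftrightarrow> (a :: (real, 'n::{finite,linorder}) vec) \<in> long_roots"
proof -
  have "- a \<in> long_roots" if a: "a \<in> long_roots" for a :: "(real, 'n) vec"
  proof -
    obtain v v' where "v \<in> signed_basis" "v' \<in> signed_basis" "v' \<noteq> v" "v' \<noteq> - v" "a = v + v'"
      using a unfolding long_roots_def by auto
    then have "- a = - v + - v' \<and> - v \<in> signed_basis \<and> - v' \<in> signed_basis \<and> - v' \<noteq> - v \<and> - v' \<noteq> - (- v)"
      by (auto simp: minus_equation_iff)
    then show ?thesis unfolding long_roots_def by blast
  qed
  from this[of a] this[of "- a"] show ?thesis by auto
qed

lemma rho_long_nz: "a \<in> long_roots \<Longrightarrow> rho (a :: (real, 'n::{finite,linorder}) vec) \<noteq> 0"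
  unfolding long_roots_def using rho_add_nz by blast

lemma Phi_short_pos_eq: "Phi_short_pos = {v \<in> (signed_basis :: (real, 'n::{finite,linorder}) vec set). rho v > 0}"
  unfolding Phi_short_pos_def
  by (force elim!: rho_pos_evec simp: evec_signed_basis rho_evec)

text \<open>The height of \<open>evec i - evec j\<close> is j - i, so its sign recovers the order of
  the indices. A sum of two negative basis vectors is excluded by its negative height, and in
  \<open>evec i + evec j\<close> the indices may be exchanged.\<close>

lemma Phi_long_pos_eq: "Phi_long_pos = {a \<in> (long_roots :: (real, 'n::{finite,linorder}) vec set). rho a > 0}"
proof (intro equalityI subsetI)
  fix a :: "(real, 'n) vec" assume "a \<in> Phi_long_pos"
  then obtain i j where ij: "1 \<le> i" "i < j" "j \<le> CARD('n)" and a: "a = evec i + evec j \<or> a = evec i + - evec j"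
    unfolding Phi_long_pos_def by auto
  have m: "evec i \<in> (signed_basis :: (real, 'n) vec set)" "evec j \<in> (signed_basis :: (real, 'n) vec set)"
    using ij by (auto intro: evec_signed_basis)
  have ne: "evec j \<noteq> (evec i :: (real, 'n) vec)" "evec j \<noteq> (- evec i :: (real, 'n) vec)"
    using signed_basis_inner[OF m] evec_inner[of i j, where 'n='n] ij by (auto split: if_splits)
  have "a \<in> long_roots"
  proof (cases "a = evec i + evec j")
    case True then show ?thesis using m ne unfolding long_roots_def by blast
  next
    case False then have "a = evec i + - evec j" using a by simp
    moreover have "- evec j \<in> (signed_basis :: (real, 'n) vec set)" using m by simp
    moreover have "- evec j \<noteq> (evec i :: (real, 'n) vec)" "- evec j \<noteq> (- evec i :: (real, 'n) vec)"
      using ne by (auto simp: minus_equation_iff)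
    ultimately show ?thesis using m unfolding long_roots_def by blast
  qed
  moreover have "rho a > 0" using a ij by (auto simp: rho_add rho_minus rho_diff rho_evec)
  ultimately show "a \<in> {a \<in> long_roots. rho a > 0}" by simp
next
  fix a :: "(real, 'n) vec" assume "a \<in> {a \<in> long_roots. rho a > 0}"
  then obtain v v' where v: "v \<in> signed_basis" "v' \<in> signed_basis" "v' \<noteq> v" "v' \<noteq> - v" "a = v + v'" "rho a > 0"
    unfolding long_roots_def by auto
  have pos: "evec i + evec j \<in> (Phi_long_pos :: (real, 'n) vec set)" if "i \<in> {1..CARD('n)}" "j \<in> {1..CARD('n)}" "i \<noteq> j"
    for i j
  proof (cases "i < j")
    case True then show ?thesis using that unfolding Phi_long_pos_def by auto
  next
    case False then have "evec i + evec j = (evec j + evec i :: (real, 'n) vec)" "j < i" using that by auto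
    then show ?thesis using that unfolding Phi_long_pos_def by (metis (mono_tags, lifting) UnI1 atLeastAtMost_iff mem_Collect_eq)
  qed
  have neg: "evec i - evec j \<in> (Phi_long_pos :: (real, 'n) vec set)"
    if "i \<in> {1..CARD('n)}" "j \<in> {1..CARD('n)}" "rho (evec i - evec j :: (real, 'n) vec) > 0" for i j
    using that unfolding Phi_long_pos_def by (auto simp: rho_diff rho_evec)
  from v(1) show "a \<in> Phi_long_pos"
  proof (cases rule: signed_basisE)
    case (1 i) note i = this
    from v(2) show ?thesis
    proof (cases rule: signed_basisE)
      case (1 j) then show ?thesis using i v pos[of i j] by auto
    next
      case (2 j) then show ?thesis using i v neg[of i j] by auto
    qed
  next
    case (2 i) note i = this
    from v(2) show ?thesis
    proof (cases rule: signed_basisE)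
      case (1 j) then show ?thesis using i v neg[of j i] by auto
    next
      case (2 j)
      have "rho a < 0" using i 2 v(5) rho_evec_pos[of i, where 'n='n] rho_evec_pos[of j, where 'n='n]
        by (simp add: rho_diff rho_minus)
      then show ?thesis using v by simp
    qed
  qed
qed

lemma Phi_neg_eq: "Phi_neg = {a \<in> (long_roots \<union> signed_basis :: (real, 'n::{finite,linorder}) vec set). rho a < 0}"
proof (intro equalityI subsetI)
  fix a :: "(real, 'n) vec" assume "a \<in> {a \<in> long_roots \<union> signed_basis. rho a < 0}"
  then have "- a \<in> Phi_pos" unfolding Phi_pos_def Phi_long_pos_eq Phi_short_pos_eq by (auto simp: rho_minus)
  then show "a \<in> Phi_neg" unfolding Phi_neg_def by (metis imageI minus_minus)
qed (auto simp: Phi_neg_def Phi_pos_def Phi_long_pos_eq Phi_short_pos_eq rho_minus)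

section \<open>The group of signed permutations\<close>

lemma W_carrier: "w \<in> carrier W \<longleftrightarrow> linear w \<and> w ` signed_basis = signed_basis"
  by (simp add: W_def)

lemma W_linear: "w \<in> carrier W \<Longrightarrow> linear w"
  and W_image: "w \<in> carrier W \<Longrightarrow> w ` signed_basis = signed_basis"
  by (auto simp: W_carrier)

lemma W_mem: "w \<in> carrier W \<Longrightarrow> v \<in> signed_basis \<Longrightarrow> w v \<in> signed_basis"
  using W_image by blast

lemma W_mult [simp]: "x \<otimes>\<^bsub>W\<^esub> y = x \<circ> y"
  by (simp add: W_def)

lemma W_one [simp]: "\<one>\<^bsub>W\<^esub> = id"
  by (simp add: W_def)

text \<open>The signed basis spans and is mapped onto itself, which gives surjectivity; in finite
  dimension a surjective linear map is injective.\<close>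

lemma W_bij:
  fixes w :: "('n::{finite,linorder}) endo"
  assumes "w \<in> carrier W"
  shows "bij w"
proof -
  have "span (signed_basis :: (real, 'n) vec set) = UNIV"
    using span_mono[of Basis "signed_basis :: (real, 'n) vec set"] by (auto simp: signed_basis_eq)
  then have "surj w"
    using linear_span_image[OF W_linear[OF assms], of signed_basis] W_image[OF assms] by metis
  then show ?thesis
    using W_linear[OF assms] linear_surjective_imp_injective by (auto simp: bij_def)
qed

lemma W_inv_mem:
  fixes w :: "('n::{finite,linorder}) endo"
  assumes "w \<in> carrier W"
  shows "inv_into UNIV w \<in> carrier W"
proof -
  have b: "bij w" using W_bij[OF assms] .
  have "linear (inv_into UNIV w)"
    using linear_inj_imp_surj W_linear[OF assms] b by (metis bij_betw_def inj_linear_imp_inv_linear)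
  moreover have "inv_into UNIV w ` signed_basis = signed_basis"
    using W_image[OF assms] b by (metis bij_betw_def image_inv_f_f)
  ultimately show ?thesis by (simp add: W_carrier)
qed

lemma W_comp: "x \<in> carrier W \<Longrightarrow> y \<in> carrier W \<Longrightarrow> x \<circ> y \<in> carrier W"
  by (simp add: W_carrier linear_compose image_comp[symmetric] del: comp_apply)

lemma group_W: "group (W :: (('n::{finite,linorder}) endo) monoid)"
proof (rule groupI)
  fix x :: "'n endo" assume x: "x \<in> carrier W"
  then show "\<exists>y\<in>carrier W. y \<otimes>\<^bsub>W\<^esub> x = \<one>\<^bsub>W\<^esub>"
    using W_inv_mem[OF x] W_bij[OF x] by (intro bexI[of _ "inv_into UNIV x"]) (auto simp: bij_is_inj)
qed (simp_all add: W_comp comp_assoc W_carrier[of id] linear_id del: comp_apply)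

interpretation W: group W
  by (rule group_W)

lemma W_pow: "w \<in> carrier W \<Longrightarrow> (w ^^ k) \<in> carrier W"
  by (induction k) (auto simp: W_comp W.one_closed[simplified])

lemma long_roots_image:
  assumes "w \<in> carrier W" "a \<in> (long_roots :: (real, 'n::{finite,linorder}) vec set)"
  shows "w a \<in> long_roots"
proof -
  obtain v v' where v: "v \<in> signed_basis" "v' \<in> signed_basis" "v' \<noteq> v" "v' \<noteq> - v" "a = v + v'"
    using assms unfolding long_roots_def by auto
  have "w v' \<noteq> w v" "w v' \<noteq> - w v"
    using W_bij[OF assms(1)] v linear_neg[OF W_linear[OF assms(1)], of v] by (metis bij_def injD)+
  then show ?thesis
    using v W_mem[OF assms(1)] linear_add[OF W_linear[OF assms(1)]] unfolding long_roots_def by blast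
qed

text \<open>Since \<open>w\<close> maps long roots to long roots, membership of the image in
  \<open>Phi_neg\<close> reduces to a sign condition on its height.\<close>

lemma Lambda_eq:
  assumes "w \<in> carrier W"
  shows "Lambda w = {a \<in> long_roots. rho a > 0 \<and> rho (w a :: (real, 'n::{finite,linorder}) vec) < 0}"
  unfolding Lambda_def Phi_long_pos_eq Phi_neg_eq using long_roots_image[OF assms] by auto

lemma Sigma_eq:
  assumes "w \<in> carrier W"
  shows "Sigma_short w = {v \<in> signed_basis. rho v > 0 \<and> rho (w v :: (real, 'n::{finite,linorder}) vec) < 0}"
  unfolding Sigma_short_def Phi_short_pos_eq Phi_neg_eq using W_mem[OF assms] by auto

section \<open>Pairs of basis vectors and descents\<close>

lemma card_signed_basis: "card (signed_basis :: (real, 'n::{finite,linorder}) vec set) = 2 * CARD('n)"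
proof -
  have "b \<noteq> - b'" if "b \<in> Basis" "b' \<in> Basis" for b b' :: "(real, 'n) vec"
    using signed_basis_inner[of b "- b'"] that inner_Basis[of b b'] by (auto simp: signed_basis_eq split: if_splits)
  then have "card (signed_basis :: (real, 'n) vec set) = card (Basis :: (real, 'n) vec set) + card (uminus ` (Basis :: (real, 'n) vec set))"
    unfolding signed_basis_eq by (intro card_Un_disjoint) auto
  then show ?thesis by (simp add: card_image)
qed

lemma finite_long_roots: "finite (long_roots :: (real, 'n::{finite,linorder}) vec set)"
proof (rule finite_subset)
  show "long_roots \<subseteq> (\<lambda>(v, v'). v + v') ` (signed_basis \<times> (signed_basis :: (real, 'n) vec set))"
    unfolding long_roots_def by auto
qed (simp add: finite_signed_basis)

text \<open>Pairs are ordered so that the set is a union of pieces lying in products of two orbits,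
  without a choice of which summand belongs to which orbit.\<close>

definition root_pairs :: "((real, 'n::{finite,linorder}) vec \<times> (real, 'n) vec) set" where
  "root_pairs = {(v, v'). v \<in> signed_basis \<and> v' \<in> signed_basis \<and> v' \<noteq> v \<and> v' \<noteq> - v}"

text \<open>A long root is the sum of two signed basis vectors in exactly two ways, one for each order of the summands.\<close>

lemma card_root_pairs:
  assumes S: "S \<subseteq> (long_roots :: (real, 'n::{finite,linorder}) vec set)"
  shows "card {p \<in> root_pairs. fst p + snd p \<in> S} = 2 * card S"
proof -
  define F where "F a = {p \<in> root_pairs. fst p + snd p = a}" for a :: "(real, 'n) vec"
  have F: "card (F a) = 2 \<and> finite (F a)" if aS: "a \<in> S" for a
  proof -
    obtain v v' where v: "v \<in> signed_basis" "v' \<in> signed_basis" "v' \<noteq> v" "v' \<noteq> - v" and a: "a = v + v'"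
      using S aS unfolding long_roots_def by auto
    have sub: "x = v \<or> x = v'" if x: "x \<in> signed_basis" "y \<in> signed_basis" "y \<noteq> x" "y \<noteq> - x" "x + y = a" for x y
    proof -
      have "x \<noteq> - y" "x \<noteq> y" using x by (auto simp: minus_equation_iff[of y x])
      \<comment> \<open>The inner product with the sum singles out the summands: a signed basis
        vector has inner product 1 with \<open>v + v'\<close> only if it is one of the two.\<close>
      then have "x \<bullet> (x + y) = 1" using x(1-3) by (simp add: inner_add_right signed_basis_inner)
      then have "x \<bullet> v + x \<bullet> v' = 1" using x(5) a by (simp add: inner_add_right)
      then show ?thesis using x v by (simp add: signed_basis_inner split: if_splits)
    qed
    have "F a = {(v, v'), (v', v)}"
    proof (intro equalityI subsetI)
      fix p assume "p \<in> F a"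
      then obtain x y where p: "p = (x, y)" "x \<in> signed_basis" "y \<in> signed_basis" "y \<noteq> x" "y \<noteq> - x" "x + y = a"
        by (cases p) (auto simp: F_def root_pairs_def)
      moreover have "x = v \<or> x = v'" using sub p by blast
      ultimately show "p \<in> {(v, v'), (v', v)}" using a by auto
    next
      fix p assume "p \<in> {(v, v'), (v', v)}"
      moreover have "v \<noteq> - v'" using v(4) by auto
      ultimately show "p \<in> F a" using v a by (auto simp: F_def root_pairs_def add.commute)
    qed
    then show ?thesis using v(3) by simp
  qed
  have "{p \<in> root_pairs. fst p + snd p \<in> S} = (\<Union>a\<in>S. F a)"
    by (auto simp: F_def)
  also have "card \<dots> = (\<Sum>a\<in>S. card (F a))"
    using F finite_subset[OF S finite_long_roots] by (intro card_UN_disjoint) (auto simp: F_def)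
  also have "\<dots> = 2 * card S" using F by simp
  finally show ?thesis .
qed

lemma finite_root_pairs: "finite (root_pairs :: ((real, 'n::{finite,linorder}) vec \<times> (real, 'n) vec) set)"
  by (rule finite_subset[of _ "signed_basis \<times> signed_basis"]) (auto simp: root_pairs_def finite_signed_basis)

lemma root_pairs_sum: "p \<in> root_pairs \<Longrightarrow> fst p + snd p \<in> long_roots"
  unfolding root_pairs_def long_roots_def by (cases p) auto

text \<open>There are 2n choices for the first vector of a pair and 2n - 2 for the second. Each root
  arises from two orders, and half of the long roots are positive, whence the division by 4.\<close>

lemma card_Phi_long_pos:
  "card (Phi_long_pos :: (real, 'n::{finite,linorder}) vec set) = CARD('n) * (CARD('n) - 1)"
proof -
  let ?L = "long_roots :: (real, 'n) vec set"
  let ?B = "signed_basis :: (real, 'n) vec set"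
  have "(root_pairs :: ((real, 'n) vec \<times> (real, 'n) vec) set) = (SIGMA v:?B. ?B - {v, - v})"
    by (auto simp: root_pairs_def)
  then have "card (root_pairs :: ((real, 'n) vec \<times> (real, 'n) vec) set) = (\<Sum>v\<in>?B. card (?B - {v, - v}))"
    using card_SigmaI[OF finite_signed_basis, of "\<lambda>v. ?B - {v, - v}"] finite_signed_basis by fastforce
  also have "\<dots> = (\<Sum>v\<in>?B. 2 * CARD('n) - 2)"
  proof (rule sum.cong[OF refl])
    fix v assume v: "v \<in> ?B"
    then have "card (?B - {v, - v}) = card ?B - card {v, - v}"
      by (intro card_Diff_subset) auto
    then show "card (?B - {v, - v}) = 2 * CARD('n) - 2"
      using signed_basis_neq_minus[OF v] by (simp add: card_signed_basis)
  qed
  also have "root_pairs = {p \<in> root_pairs. fst p + snd p \<in> ?L}"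
    using root_pairs_sum by blast
  finally have "2 * card ?L = (2 * CARD('n)) * (2 * CARD('n) - 2)"
    using card_root_pairs[of ?L] by (simp add: card_signed_basis)
  moreover have "card ?L = 2 * card (Phi_long_pos :: (real, 'n) vec set)"
  proof -
    have "?L = Phi_long_pos \<union> uminus ` Phi_long_pos"
    proof (intro equalityI subsetI)
      fix a assume a: "a \<in> ?L"
      show "a \<in> Phi_long_pos \<union> uminus ` Phi_long_pos"
      proof (cases "rho a > 0")
        case False
        then have "- a \<in> Phi_long_pos" using a rho_long_nz[OF a] by (simp add: Phi_long_pos_eq rho_minus)
        then show ?thesis by (metis UnI2 imageI minus_minus)
      qed (use a in \<open>simp add: Phi_long_pos_eq\<close>)
    qed (auto simp: Phi_long_pos_eq)
    moreover have "Phi_long_pos \<inter> uminus ` Phi_long_pos = ({} :: (real, 'n) vec set)"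
      by (auto simp: Phi_long_pos_eq rho_minus)
    moreover have "finite (Phi_long_pos :: (real, 'n) vec set)"
      by (rule finite_subset[OF _ finite_long_roots]) (auto simp: Phi_long_pos_eq)
    ultimately have "card ?L = card (Phi_long_pos :: (real, 'n) vec set) + card (uminus ` (Phi_long_pos :: (real, 'n) vec set))"
      by (metis card_Un_disjoint finite_imageI)
    then show ?thesis by (simp add: card_image)
  qed
  ultimately show ?thesis
    by (cases "CARD('n)") auto
qed

definition inv_pairs :: "('n::{finite,linorder}) endo \<Rightarrow> ((real, 'n) vec \<times> (real, 'n) vec) set" where
  "inv_pairs w = {(v, v') \<in> root_pairs. rho (v + v') > 0 \<and> rho (w (v + v')) < 0}"

lemma finite_inv_pairs: "finite (inv_pairs w)"
  by (rule finite_subset[OF _ finite_root_pairs]) (auto simp: inv_pairs_def)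

lemma card_inv_pairs:
  assumes "w \<in> carrier W"
  shows "card (inv_pairs w) = 2 * card (Lambda w)"
proof -
  have "inv_pairs w = {p \<in> root_pairs. fst p + snd p \<in> Lambda w}"
    unfolding inv_pairs_def Lambda_eq[OF assms] using root_pairs_sum by fastforce
  then show ?thesis
    using card_root_pairs[of "Lambda w"] by (simp add: Lambda_eq[OF assms])
qed

lemma swap_inv_pairs:
  assumes "(v, v') \<in> inv_pairs w" shows "(v', v) \<in> inv_pairs w"
  using assms unfolding inv_pairs_def root_pairs_def by (auto simp: add.commute minus_equation_iff)

section \<open>Sign changes of real sequences\<close>

lemma descent_before:
  fixes f :: "nat \<Rightarrow> real"
  assumes "f 0 > 0" "f m < 0" and nz: "\<And>k. f k \<noteq> 0"
  obtains k where "k < m" "f k > 0" "f (Suc k) < 0"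
proof -
  define l where "l = (LEAST l. f l < 0)"
  have l: "f l < 0" "l \<le> m" unfolding l_def using assms(2) by (auto intro: LeastI Least_le)
  then obtain k where k: "l = Suc k" using assms(1) by (cases l) auto
  have "\<not> f k < 0" using not_less_Least[of k "\<lambda>l. f l < 0"] k l_def by simp
  then show ?thesis using that[of k] k l nz[of k] by auto
qed

text \<open>The values at 0 and at m have opposite signs. If the one at 0 is negative, the search
  starts at m, where the value is positive and becomes negative again after m further steps.\<close>

lemma descent_antiperiodic:
  fixes f :: "nat \<Rightarrow> real"
  assumes f: "\<And>k. f (k + m) = - f k" and nz: "\<And>k. f k \<noteq> 0"
  obtains k where "f k > 0" "f (Suc k) < 0"
proof (cases "f 0 > 0")
  case True
  then show ?thesis using descent_before[of f m] f[of 0] nz that by (metis add_0 neg_less_0_iff_less)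
next
  case False
  then have "f m > 0" "f (m + m) < 0" using f[of 0] f[of m] nz[of 0] by auto
  then show ?thesis using descent_before[of "\<lambda>k. f (k + m)" m] nz that[of "_ + m"] by (metis add_0 add_Suc)
qed

text \<open>A nowhere vanishing sequence whose sum over a period is 0 takes both signs, and
  periodicity moves a negative value beyond a positive one.\<close>

lemma descent_periodic:
  fixes f :: "nat \<Rightarrow> real"
  assumes f: "\<And>k. f (k + m) = f k" and nz: "\<And>k. f k \<noteq> 0" and "(\<Sum>k<m. f k) = 0" "m > 0"
  obtains k where "f k > 0" "f (Suc k) < 0"
proof -
  obtain a where a: "f a > 0"
  proof (rule ccontr)
    assume "\<not> thesis"
    then have "f k < 0" for k using that nz[of k] by (metis linorder_cases)
    then have "(\<Sum>k<m. f k) < (\<Sum>k<m. 0)" using assms(4) by (intro sum_strict_mono) auto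
    then show False using assms(3) by simp
  qed
  obtain c where c: "f c < 0"
  proof (rule ccontr)
    assume "\<not> thesis"
    then have "f k > 0" for k using that nz[of k] by (metis linorder_cases)
    then have "(\<Sum>k<m. 0) < (\<Sum>k<m. f k)" using assms(4) by (intro sum_strict_mono) auto
    then show False using assms(3) by simp
  qed
  have per: "f (c + j * m) = f c" for j
    by (induction j) (use f in \<open>simp_all add: add.assoc[symmetric] add.commute[of m]\<close>)
  \<comment> \<open>Because the period is at least 1, shifting the index of the negative value by a
    periods carries it past a.\<close>
  have "c + a * m \<ge> a" using \<open>m > 0\<close> by (cases m) auto
  then obtain d where d: "c + a * m = a + d" using le_Suc_ex by blast
  then have "f (a + d) < 0" using per[of a] c by simp
  then show ?thesis using descent_before[of "\<lambda>k. f (a + k)" d] a nz that by (metis add.right_neutral add_Suc_right)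
qed

text \<open>Needed for the difference of a periodic sequence and a shift of it, whose sum over a
  period is therefore 0.\<close>

lemma sum_periodic_shift:
  fixes g :: "nat \<Rightarrow> real"
  assumes "\<And>k. g (k + m) = g k"
  shows "(\<Sum>k<m. g (k + d)) = (\<Sum>k<m. g k)"
proof (induction d)
  case (Suc d)
  have "(\<Sum>k<Suc m. g (k + d)) = g d + (\<Sum>k<m. g (k + Suc d))"
    by (subst sum.lessThan_Suc_shift) simp
  moreover have "(\<Sum>k<Suc m. g (k + d)) = (\<Sum>k<m. g (k + d)) + g d"
    using assms[of d] by (simp add: add.commute)
  ultimately show ?case using Suc by simp
qed simp

text \<open>A descent between steps k and k + 1 of the height sequence of a pair is an inversion at
  the k-th iterate of the pair, since one more application of \<open>w\<close> takes its sum from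
  positive to negative.\<close>

lemma inv_pairs_pow:
  assumes w: "w \<in> carrier W" and v: "v \<in> signed_basis" "v' \<in> signed_basis" "v' \<noteq> v" "v' \<noteq> - v"
    and "rho ((w ^^ k) v + (w ^^ k) v') > 0" "rho ((w ^^ Suc k) v + (w ^^ Suc k) v') < 0"
  shows "((w ^^ k) v, (w ^^ k) v') \<in> inv_pairs w"
proof -
  note p = W_pow[OF w, of k]
  have "(w ^^ k) v' \<noteq> (w ^^ k) v" "(w ^^ k) v' \<noteq> - (w ^^ k) v"
    using W_bij[OF p] v linear_neg[OF W_linear[OF p], of v] by (metis bij_def injD)+
  then show ?thesis
    using assms W_mem[OF p] by (auto simp: inv_pairs_def root_pairs_def linear_add[OF W_linear[OF w]])
qed

lemma rho_pow_nz:
  assumes w: "w \<in> carrier W" and v: "v \<in> signed_basis" "v' \<in> signed_basis" "v' \<noteq> - v"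
  shows "rho ((w ^^ k) v + (w ^^ k) v') \<noteq> 0"
proof (rule rho_add_nz)
  note p = W_pow[OF w, of k]
  show "(w ^^ k) v' \<noteq> - (w ^^ k) v"
    using W_bij[OF p] v linear_neg[OF W_linear[OF p], of v] by (metis bij_def injD)
qed (use v W_mem[OF W_pow[OF w]] in auto)

section \<open>Inversions along orbits\<close>

text \<open>The cycles of \<open>w\<close> without reference to indices: \<open>b i\<close> is a
  starting vector on cycle i and \<open>eps i\<close> is - 1 exactly for a negative cycle. The
  scalar s is separate from the power because the 2 \<open>lam i\<close> vectors of a cycle form a
  single orbit under \<open>w\<close> if the cycle is negative, but two opposite orbits if it is
  positive; closing under negation treats both alike.\<close>

locale orbit_system =
  fixes w :: "('n::{finite,linorder}) endo" and z :: nat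
    and b :: "nat \<Rightarrow> (real, 'n) vec" and lam :: "nat \<Rightarrow> nat" and eps :: "nat \<Rightarrow> real"
  assumes w_W: "w \<in> carrier W"
    and base: "i < z \<Longrightarrow> b i \<in> signed_basis"
    and lam_pos: "i < z \<Longrightarrow> 0 < lam i"
    and eps: "i < z \<Longrightarrow> eps i \<in> {1, - 1}"
    and period: "i < z \<Longrightarrow> (w ^^ lam i) (b i) = eps i *\<^sub>R b i"
    and bij: "bij_betw (\<lambda>(s, i, k). s *\<^sub>R (w ^^ k) (b i))
      ({1, - 1} \<times> (SIGMA i:{..<z}. {..<lam i})) signed_basis"
begin

definition orb :: "nat \<Rightarrow> (real, 'n) vec set" where
  "orb i = (\<lambda>(s, k). s *\<^sub>R (w ^^ k) (b i)) ` ({1, - 1} \<times> {..<lam i})"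

lemma orbE:
  assumes "v \<in> orb i"
  obtains s k where "s \<in> {1, - 1}" "k < lam i" "v = s *\<^sub>R (w ^^ k) (b i)"
  using assms unfolding orb_def by auto

lemma pow_linear: "linear (w ^^ k)"
  by (rule W_linear[OF W_pow[OF w_W]])

lemma pow_inj: "(w ^^ k) x = (w ^^ k) y \<longleftrightarrow> x = y"
  using W_bij[OF W_pow[OF w_W, of k]] by (metis bij_def injD)

lemma pow_scale: "(w ^^ k) (r *\<^sub>R x) = r *\<^sub>R (w ^^ k) x"
  by (rule linear_scale[OF pow_linear])

lemma pow_neg: "(w ^^ k) (- x) = - (w ^^ k) x"
  by (rule linear_neg[OF pow_linear])

lemma pow_mem: "v \<in> signed_basis \<Longrightarrow> (w ^^ k) v \<in> signed_basis"
  by (rule W_mem[OF W_pow[OF w_W]])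

lemma index_unique:
  assumes "s *\<^sub>R (w ^^ k) (b i) = s' *\<^sub>R (w ^^ k') (b i')"
    and "s \<in> {1, - 1}" "s' \<in> {1, - 1}" "i < z" "i' < z" "k < lam i" "k' < lam i'"
  shows "s = s' \<and> i = i' \<and> k = k'"
proof -
  have "(s, i, k) = (s', i', k')"
    by (rule inj_onD[OF bij_betw_imp_inj_on[OF bij]]) (use assms in auto)
  then show ?thesis by simp
qed

lemma orb_sub: "i < z \<Longrightarrow> orb i \<subseteq> signed_basis"
  unfolding orb_def using pow_mem[OF base] by auto

lemma finite_orb: "finite (orb i)"
  by (simp add: orb_def)

lemma card_orb: assumes "i < z" shows "card (orb i) = 2 * lam i"
proof -
  have "inj_on (\<lambda>(s, k). s *\<^sub>R (w ^^ k) (b i)) ({1, - 1} \<times> {..<lam i})"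
  proof (rule inj_onI)
    fix p q assume "p \<in> {1, - 1} \<times> {..<lam i}" "q \<in> {1, - 1} \<times> {..<lam i}"
      and "(\<lambda>(s, k). s *\<^sub>R (w ^^ k) (b i)) p = (\<lambda>(s, k). s *\<^sub>R (w ^^ k) (b i)) q"
    then show "p = q"
      using index_unique[of "fst p" "snd p" i "fst q" "snd q" i] assms
      by (cases p; cases q) auto
  qed
  then show ?thesis unfolding orb_def by (simp add: card_image card_cartesian_product)
qed

lemma orb_disjoint: assumes "i < z" "j < z" "i \<noteq> j" shows "orb i \<inter> orb j = {}"
proof (rule ccontr)
  assume "orb i \<inter> orb j \<noteq> {}"
  then obtain v where "v \<in> orb i" "v \<in> orb j" by blast
  then obtain s k s' k' where "s *\<^sub>R (w ^^ k) (b i) = s' *\<^sub>R (w ^^ k') (b j)"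
    "s \<in> {1, - 1}" "s' \<in> {1, - 1}" "k < lam i" "k' < lam j"
    by (elim orbE) metis
  then show False using index_unique[of s k i s' k' j] assms by blast
qed

lemma orb_cover:
  assumes "v \<in> signed_basis"
  obtains i s k where "i < z" "s \<in> {1, - 1}" "k < lam i" "v = s *\<^sub>R (w ^^ k) (b i)"
  using assms unfolding bij_betw_imp_surj_on[OF bij, symmetric] by auto

lemma orb_base: "i < z \<Longrightarrow> b i \<in> orb i"
  unfolding orb_def using lam_pos[of i] by (force intro: image_eqI[of _ _ "(1, 0)"])

lemma orb_neg: "- v \<in> orb i \<longleftrightarrow> v \<in> orb i"
proof -
  have "- v \<in> orb i" if v: "v \<in> orb i" for v
  proof -
    obtain s k where "s \<in> {1, - 1}" "k < lam i" "v = s *\<^sub>R (w ^^ k) (b i)"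
      using v by (elim orbE)
    then have "- v = (\<lambda>(s, k). s *\<^sub>R (w ^^ k) (b i)) (- s, k)" "(- s, k) \<in> {1, - 1} \<times> {..<lam i}" by auto
    then show ?thesis unfolding orb_def by blast
  qed
  from this[of v] this[of "- v"] show ?thesis by auto
qed

lemma orb_scale: "v \<in> orb i \<Longrightarrow> s \<in> {1, - 1} \<Longrightarrow> s *\<^sub>R v \<in> orb i"
  by (auto simp: orb_neg)

lemma orb_pow: assumes i: "i < z" and v: "v \<in> orb i" shows "(w ^^ m) v \<in> orb i"
proof (induction m)
  case (Suc m)
  obtain s k where sk: "s \<in> {1, - 1}" "k < lam i" "(w ^^ m) v = s *\<^sub>R (w ^^ k) (b i)"
    using Suc unfolding orb_def by auto
  have eq: "(w ^^ Suc m) v = s *\<^sub>R (w ^^ Suc k) (b i)"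
    using sk(3) pow_scale[of 1] by simp
  show ?case
  proof (cases "Suc k < lam i")
    case True
    then have "(w ^^ Suc k) (b i) \<in> orb i"
      unfolding orb_def by (intro image_eqI[of _ _ "(1, Suc k)"]) auto
    then show ?thesis using eq sk(1) orb_scale by simp
  next
    case False
    then have "Suc k = lam i" using sk(2) by simp
    then have "(w ^^ Suc k) (b i) = eps i *\<^sub>R b i" using period[OF i] by simp
    then show ?thesis using eq orb_scale[OF orb_scale[OF orb_base[OF i] eps[OF i]] sk(1)] by simp
  qed
qed (use v in simp)

lemma pow_commute: "(w ^^ k) ((w ^^ m) x) = (w ^^ m) ((w ^^ k) x)"
  by (metis add.commute comp_apply funpow_add)

lemma period_orb: assumes "i < z" "v \<in> orb i" shows "(w ^^ lam i) v = eps i *\<^sub>R v"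
  using assms(2) by (elim orbE) (simp add: pow_scale pow_commute[of "lam i"] period[OF assms(1)] mult.commute)

text \<open>Multiplication by s and application of \<open>w ^^ k\<close> are injective and commute
  with \<open>w ^^ d\<close>. This reduces the claim to the starting vector, where the indexing by
  (s, i, k) is unique.\<close>

lemma pow_distinct:
  assumes "i < z" "0 < d" "d < lam i" "v \<in> orb i"
  shows "(w ^^ d) v \<noteq> v" "(w ^^ d) v \<noteq> - v"
proof -
  obtain s k where v: "v = s *\<^sub>R (w ^^ k) (b i)" "s \<in> {1, - 1}" using assms(4) by (elim orbE)
  have ne: "(w ^^ d) (b i) \<noteq> s' *\<^sub>R b i" if "s' \<in> {1, - 1}" for s'
    using index_unique[of 1 d i s' 0 i] assms that lam_pos[of i] by auto
  have *: "(w ^^ d) v = s' *\<^sub>R v \<longleftrightarrow> (w ^^ d) (b i) = s' *\<^sub>R b i" for s'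
  proof -
    have "(w ^^ d) v = s *\<^sub>R (w ^^ k) ((w ^^ d) (b i))" "s' *\<^sub>R v = s *\<^sub>R (w ^^ k) (s' *\<^sub>R b i)"
      using v by (simp_all add: pow_scale pow_commute[of d] mult.commute)
    then show ?thesis using v(2) pow_inj[of k] by auto
  qed
  show "(w ^^ d) v \<noteq> v" using *[of 1] ne[of 1] by simp
  show "(w ^^ d) v \<noteq> - v" using *[of "- 1"] ne[of "- 1"] by simp
qed

lemma orb_pow_eq:
  assumes "v \<in> orb i" "(w ^^ j) (b i) = (w ^^ j') (b i)"
  shows "(w ^^ j) v = (w ^^ j') v"
  using assms(1) by (elim orbE) (simp add: pow_scale pow_commute[of j] pow_commute[of j'] assms(2))

text \<open>The exponents belonging to two vectors may differ, but if the first components agree,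
  then so do the two powers of \<open>w\<close> on the whole orbit, since its vectors are signed
  iterates of \<open>b i\<close>. Injectivity of a power then recovers the second component.\<close>

lemma inj_on_pow_pair:
  assumes "V \<subseteq> orb i"
  shows "inj_on (\<lambda>v. ((w ^^ j v) (b i), (w ^^ j v) v)) V"
proof (rule inj_onI)
  fix x y assume xy: "x \<in> V" "y \<in> V"
    "((w ^^ j x) (b i), (w ^^ j x) x) = ((w ^^ j y) (b i), (w ^^ j y) y)"
  then have "(w ^^ j y) y = (w ^^ j x) y" using orb_pow_eq[of y i "j y" "j x"] assms by auto
  then show "x = y" using xy(3) pow_inj by simp
qed

text \<open>After \<open>lam i\<close> steps every vector of a negative cycle has changed sign, so
  the height sequence of \<open>b i\<close> and a partner is antiperiodic and has a descent. There
  are 2 \<open>lam i\<close> - 2 partners, all vectors of the orbit except \<open>b i\<close> and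
  its negative.\<close>

lemma card_inv_pairs_diag_neg:
  assumes i: "i < z" and e: "eps i = - 1"
  shows "2 * (lam i - 1) \<le> card (inv_pairs w \<inter> orb i \<times> orb i)"
proof -
  define V where "V = orb i - {b i, - b i}"
  have bi: "b i \<in> orb i" "b i \<in> signed_basis" using orb_base[OF i] base[OF i] by auto
  have "\<exists>j. ((w ^^ j) (b i), (w ^^ j) v) \<in> inv_pairs w" if v: "v \<in> V" for v
  proof -
    have vb: "v \<in> signed_basis" "v \<noteq> - b i" "v \<noteq> b i" "v \<in> orb i" using v orb_sub[OF i] by (auto simp: V_def)
    let ?f = "\<lambda>k. rho ((w ^^ k) (b i) + (w ^^ k) v)"
    have "?f (k + lam i) = - ?f k" for k
    proof -
      have "(w ^^ (k + lam i)) x = - (w ^^ k) x" if "x \<in> orb i" for x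
        using period_orb[OF i that] e by (simp add: funpow_add pow_neg)
      then show ?thesis using bi vb by (simp add: rho_minus[symmetric])
    qed
    then obtain k where "?f k > 0" "?f (Suc k) < 0"
      using descent_antiperiodic[of ?f "lam i"] rho_pow_nz[OF w_W bi(2) vb(1,2)] by blast
    then show ?thesis using inv_pairs_pow[OF w_W bi(2) vb(1,3,2)] by blast
  qed
  then obtain j where j: "\<And>v. v \<in> V \<Longrightarrow> ((w ^^ j v) (b i), (w ^^ j v) v) \<in> inv_pairs w" by metis
  have "card V = card (orb i) - card {b i, - b i}"
    unfolding V_def using bi orb_neg by (intro card_Diff_subset) auto
  then have "card V = 2 * (lam i - 1)"
    using card_orb[OF i] signed_basis_neq_minus[OF bi(2)] by simp
  moreover have "card V \<le> card (inv_pairs w \<inter> orb i \<times> orb i)"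
  proof (rule card_inj_on_le[OF inj_on_pow_pair[of V i j]])
    show "(\<lambda>v. ((w ^^ j v) (b i), (w ^^ j v) v)) ` V \<subseteq> inv_pairs w \<inter> orb i \<times> orb i"
      using j orb_pow[OF i] bi by (auto simp: V_def)
  qed (auto simp: V_def finite_inv_pairs)
  ultimately show ?thesis by simp
qed

text \<open>
  The orbit of \<open>b i\<close> does not contain \<open>- b i\<close> here, so only \<open>lam i - 1\<close> pairs arise from \<open>b i\<close>
  itself; swapping the components gives the other half.
\<close>

lemma card_inv_pairs_diag_pos:
  assumes i: "i < z" and e: "eps i = 1"
  shows "2 * (lam i - 1) \<le> card (inv_pairs w \<inter> orb i \<times> orb i)"
proof -
  \<comment> \<open>The minus sign matters: the height sequence of \<open>b i\<close> and its
    partner becomes the difference of a periodic sequence and its shift by d, and so sums to 0 over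
    a period.\<close>
  define V where "V = (\<lambda>d. - (w ^^ d) (b i)) ` {1..<lam i}"
  have bi: "b i \<in> orb i" "b i \<in> signed_basis" using orb_base[OF i] base[OF i] by auto
  have VO: "V \<subseteq> orb i" using orb_pow[OF i bi(1)] by (auto simp: V_def orb_neg)
  have "\<exists>j. ((w ^^ j) (b i), (w ^^ j) v) \<in> inv_pairs w" if v: "v \<in> V" for v
  proof -
    obtain d where "d \<in> {1..<lam i}" and vd: "v = - (w ^^ d) (b i)" using v unfolding V_def by blast
    then have d: "0 < d" "d < lam i" by auto
    have vb: "v \<in> signed_basis" "v \<noteq> b i" "v \<noteq> - b i"
      using vd pow_mem[OF bi(2)] pow_distinct[OF i d(1,2) bi(1)] by (auto simp: minus_equation_iff[of _ "b i"])
    let ?g = "\<lambda>k. rho ((w ^^ k) (b i))"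
    let ?f = "\<lambda>k. rho ((w ^^ k) (b i) + (w ^^ k) v)"
    have g: "?g (k + lam i) = ?g k" for k
      using period[OF i] e by (simp add: funpow_add)
    have f: "?f k = ?g k - ?g (k + d)" for k
      using vd by (simp add: pow_neg rho_diff funpow_add)
    have "?f (k + lam i) = ?f k" for k
      unfolding f using g[of k] g[of "k + d"] by (simp add: add.commute add.left_commute)
    moreover have "(\<Sum>k<lam i. ?f k) = 0"
      unfolding f sum_subtractf using sum_periodic_shift[of ?g "lam i" d] g by simp
    ultimately obtain k where "?f k > 0" "?f (Suc k) < 0"
      using descent_periodic[of ?f "lam i"] rho_pow_nz[OF w_W bi(2) vb(1,3)] lam_pos[OF i] by blast
    then show ?thesis using inv_pairs_pow[OF w_W bi(2) vb(1,2,3)] by blast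
  qed
  then obtain j where j: "\<And>v. v \<in> V \<Longrightarrow> ((w ^^ j v) (b i), (w ^^ j v) v) \<in> inv_pairs w" by metis
  define A where "A = (\<lambda>v. ((w ^^ j v) (b i), (w ^^ j v) v)) ` V"
  have "inj_on (\<lambda>d. - (w ^^ d) (b i)) {1..<lam i}"
    using index_unique[of 1 _ i 1 _ i] i by (auto simp: inj_on_def)
  then have "card V = lam i - 1" unfolding V_def by (simp add: card_image)
  then have A: "card A = lam i - 1"
    unfolding A_def using inj_on_pow_pair[OF VO] by (simp add: card_image)
  have fin: "finite A" by (simp add: A_def V_def)
  \<comment> \<open>First components in A are iterates of \<open>b i\<close>, second components are
    negatives of iterates. An overlap would identify two vectors whose indices have different signs
    s.\<close>
  have "A \<inter> prod.swap ` A = {}"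
  proof (rule ccontr)
    assume "A \<inter> prod.swap ` A \<noteq> {}"
    then obtain v v' where v: "v \<in> V" "v' \<in> V" "(w ^^ j v) (b i) = (w ^^ j v') v'"
      by (auto simp: A_def)
    then obtain d where "v' = - (w ^^ d) (b i)" by (auto simp: V_def)
    then have eq: "(w ^^ j v) (b i) = - (w ^^ (j v' + d)) (b i)" using v(3) by (simp add: pow_neg funpow_add)
    have mod: "(w ^^ m) (b i) = (w ^^ (m mod lam i)) (b i)" for m
      using period[OF i] e by (simp add: funpow_mod_eq)
    have "1 *\<^sub>R (w ^^ (j v mod lam i)) (b i) = - 1 *\<^sub>R (w ^^ ((j v' + d) mod lam i)) (b i)"
      using eq mod[of "j v"] mod[of "j v' + d"] by simp
    then show False using index_unique[of 1 _ i "- 1" _ i] i lam_pos[OF i]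
      by (metis insertCI mod_less_divisor one_neq_neg_one)
  qed
  then have "card (A \<union> prod.swap ` A) = 2 * (lam i - 1)"
    using A fin card_image[of prod.swap A] by (simp add: card_Un_disjoint)
  moreover have "A \<union> prod.swap ` A \<subseteq> inv_pairs w \<inter> orb i \<times> orb i"
    using j VO orb_pow[OF i] bi swap_inv_pairs unfolding A_def by fastforce
  ultimately show ?thesis
    using card_mono[of "inv_pairs w \<inter> orb i \<times> orb i"] finite_inv_pairs by (metis finite_Int)
qed

lemma card_inv_pairs_diag: "i < z \<Longrightarrow> 2 * (lam i - 1) \<le> card (inv_pairs w \<inter> orb i \<times> orb i)"
  using card_inv_pairs_diag_neg card_inv_pairs_diag_pos eps by blast

lemma card_inv_pairs_swap:
  "card (inv_pairs w \<inter> orb j \<times> orb i) = card (inv_pairs w \<inter> orb i \<times> orb j)"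
proof (rule bij_betw_same_card[of prod.swap])
  show "bij_betw prod.swap (inv_pairs w \<inter> orb j \<times> orb i) (inv_pairs w \<inter> orb i \<times> orb j)"
    by (rule bij_betw_byWitness[of _ prod.swap]) (auto intro: swap_inv_pairs)
qed

text \<open>At time 0 the sum of \<open>v\<close> and any vector of orbit j has the sign of
  \<open>v\<close>, which is positive; at time \<open>lam i\<close> the vector \<open>v\<close> has
  become \<open>- v\<close> and the sum is negative. Thus each of the 2 \<open>lam j\<close> vectors
  of orbit j contributes a descent.\<close>

lemma card_inv_pairs_dominant:
  assumes ij: "i < z" "j < z" "i \<noteq> j" and e: "eps i = - 1"
    and v: "v \<in> orb i" "\<And>v'. v' \<in> orb j \<Longrightarrow> rho v' < rho v"
  shows "2 * lam j \<le> card (inv_pairs w \<inter> orb i \<times> orb j)"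
proof -
  have vb: "v \<in> signed_basis" using v orb_sub[OF ij(1)] by auto
  have "\<exists>k<lam i. ((w ^^ k) v, (w ^^ k) v') \<in> inv_pairs w" if v': "v' \<in> orb j" for v'
  proof -
    have vb': "v' \<in> signed_basis" "v' \<noteq> v" "v' \<noteq> - v"
      using v' orb_sub[OF ij(2)] orb_disjoint[OF ij] v(1) orb_neg[of v i] by auto
    let ?f = "\<lambda>k. rho ((w ^^ k) v + (w ^^ k) v')"
    \<comment> \<open>Orbit j is closed under negation, so the hypothesis on \<open>v\<close> also
      bounds the negatives of its heights.\<close>
    have "?f 0 > 0" using v(2)[of "- v'"] v' by (simp add: orb_neg rho_add rho_minus)
    moreover have "?f (lam i) < 0"
      using period_orb[OF ij(1) v(1)] e v(2)[OF orb_pow[OF ij(2) v']] by (simp add: rho_diff)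
    ultimately obtain k where "k < lam i" "?f k > 0" "?f (Suc k) < 0"
      using descent_before[of ?f "lam i"] rho_pow_nz[OF w_W vb vb'(1,3)] by blast
    then show ?thesis using inv_pairs_pow[OF w_W vb vb'] by blast
  qed
  then obtain k where k: "\<And>v'. v' \<in> orb j \<Longrightarrow> k v' < lam i \<and> ((w ^^ k v') v, (w ^^ k v') v') \<in> inv_pairs w"
    by metis
  have inj: "inj_on (\<lambda>v'. ((w ^^ k v') v, (w ^^ k v') v')) (orb j)"
  proof (rule inj_onI)
    fix x y assume xy: "x \<in> orb j" "y \<in> orb j" "((w ^^ k x) v, (w ^^ k x) x) = ((w ^^ k y) v, (w ^^ k y) y)"
    \<comment> \<open>Iterates of \<open>v\<close> with exponents below \<open>lam i\<close> are
      distinct, so the first component determines the exponent; this is why the descent was taken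
      before time \<open>lam i\<close>.\<close>
    have ne: "(w ^^ m) v \<noteq> (w ^^ (m + d)) v" if "0 < d" "d < lam i" for m d
      using pow_distinct(1)[OF ij(1) that v(1)] pow_inj[of m] by (simp add: funpow_add)
    have "k x = k y"
    proof (rule ccontr)
      assume "k x \<noteq> k y"
      then consider d where "k y = k x + d" "0 < d" | d where "k x = k y + d" "0 < d"
        by (metis less_imp_add_positive linorder_neqE_nat)
      then show False
        using k[OF xy(1)] k[OF xy(2)] xy(3) ne by cases (fastforce, metis Pair_inject add_lessD1 add.commute)
    qed
    then show "x = y" using xy(3) pow_inj by simp
  qed
  have "card (orb j) \<le> card (inv_pairs w \<inter> orb i \<times> orb j)"
  proof (rule card_inj_on_le[OF inj])
    show "(\<lambda>v'. ((w ^^ k v') v, (w ^^ k v') v')) ` orb j \<subseteq> inv_pairs w \<inter> orb i \<times> orb j"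
      using k orb_pow ij v(1) by auto
  qed (simp add: finite_inv_pairs)
  then show ?thesis using card_orb[OF ij(2)] by simp
qed

text \<open>The highest vectors of the two orbits have different heights, so one orbit dominates the
  other. The resulting bound is twice the length of the dominated cycle, and which one is dominated
  is unknown, whence the minimum.\<close>

lemma card_inv_pairs_off_diag:
  assumes ij: "i < z" "j < z" "i \<noteq> j" and e: "eps i = - 1" "eps j = - 1"
  shows "2 * min (lam i) (lam j) \<le> card (inv_pairs w \<inter> orb i \<times> orb j)"
proof -
  have ex: "\<exists>v\<in>orb l. \<forall>v'\<in>orb l. rho v' \<le> rho v" if "l < z" for l
  proof -
    have "Max (rho ` orb l) \<in> rho ` orb l" using orb_base[OF that] finite_orb by (intro Max_in) auto
    then obtain v where "v \<in> orb l" "Max (rho ` orb l) = rho v" by auto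
    then show ?thesis using finite_orb by (metis Max_ge finite_imageI imageI)
  qed
  obtain v v' where v: "v \<in> orb i" "\<And>x. x \<in> orb i \<Longrightarrow> rho x \<le> rho v"
    and v': "v' \<in> orb j" "\<And>x. x \<in> orb j \<Longrightarrow> rho x \<le> rho v'"
    using ex[OF ij(1)] ex[OF ij(2)] by blast
  have "v \<noteq> v'" using v(1) v'(1) orb_disjoint[OF ij] by auto
  then have "rho v \<noteq> rho v'" using rho_inj v(1) v'(1) orb_sub ij by blast
  then consider "rho v' < rho v" | "rho v < rho v'" by linarith
  then show ?thesis
  proof cases
    case 1
    have "2 * lam j \<le> card (inv_pairs w \<inter> orb i \<times> orb j)"
      by (rule card_inv_pairs_dominant[OF ij e(1) v(1)]) (use v'(2) 1 in force)
    then show ?thesis by simp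
  next
    case 2
    have "2 * lam i \<le> card (inv_pairs w \<inter> orb j \<times> orb i)"
      by (rule card_inv_pairs_dominant[OF ij(2,1) ij(3)[symmetric] e(2) v'(1)]) (use v(2) 2 in force)
    then show ?thesis by (simp add: card_inv_pairs_swap)
  qed
qed

text \<open>The inversion pairs are distributed over the products of two orbits. A diagonal product
  gives 2 (\<open>lam i\<close> - 1), and two negative cycles give twice the minimum in each order;
  halving yields the claim. Increasing lengths turn the minimum into the length with the smaller
  index.\<close>

lemma card_Lambda_ge:
  assumes m: "m \<le> z" and e: "\<And>i. i < m \<Longrightarrow> eps i = - 1"
    and mono: "\<And>i j. i \<le> j \<Longrightarrow> j < m \<Longrightarrow> lam i \<le> lam j"
  shows "(\<Sum>i<z. lam i - 1) + (\<Sum>i<m. \<Sum>j<i. 2 * lam j) \<le> card (Lambda w)"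
proof -
  define h where "h i j = card (inv_pairs w \<inter> orb i \<times> orb j)" for i j
  \<comment> \<open>The sum over a square is regrouped into the diagonal and the symmetric pairs
    below it.\<close>
  have split: "(\<Sum>i<z. \<Sum>j<z. h i j) = (\<Sum>i<z. h i i + (\<Sum>j<i. h i j + h j i))" for z
    by (induction z) (simp_all add: sum.distrib algebra_simps)
  have "(\<Sum>i<z. \<Sum>j<z. h i j) = (\<Sum>p\<in>{..<z} \<times> {..<z}. card (inv_pairs w \<inter> orb (fst p) \<times> orb (snd p)))"
    by (simp add: h_def sum.cartesian_product split_def)
  also have "\<dots> = card (\<Union>p\<in>{..<z} \<times> {..<z}. inv_pairs w \<inter> orb (fst p) \<times> orb (snd p))"
  proof (rule card_UN_disjoint[symmetric])
    show "\<forall>p\<in>{..<z} \<times> {..<z}. \<forall>q\<in>{..<z} \<times> {..<z}. p \<noteq> q \<longrightarrow>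
        (inv_pairs w \<inter> orb (fst p) \<times> orb (snd p)) \<inter> (inv_pairs w \<inter> orb (fst q) \<times> orb (snd q)) = {}"
      using orb_disjoint by (fastforce simp: prod_eq_iff)
  qed (auto simp: finite_inv_pairs)
  also have "\<dots> \<le> card (inv_pairs w)"
    by (rule card_mono) (auto simp: finite_inv_pairs)
  also have "\<dots> = 2 * card (Lambda w)" by (rule card_inv_pairs[OF w_W])
  finally have up: "(\<Sum>i<z. h i i + (\<Sum>j<i. h i j + h j i)) \<le> 2 * card (Lambda w)"
    unfolding split .
  \<comment> \<open>The cross terms are set to 0 from m on, where no off-diagonal bound is
    used.\<close>
  define g where "g i = (if i < m then \<Sum>j<i. 2 * lam j else 0)" for i
  have "2 * (lam i - 1) + 2 * g i \<le> h i i + (\<Sum>j<i. h i j + h j i)" if i: "i < z" for i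
  proof -
    have "2 * g i \<le> (\<Sum>j<i. h i j + h j i)"
    proof (cases "i < m")
      case True
      \<comment> \<open>The factor 4 collects 2 \<open>lam j\<close> from each of the two orders of
        the orbits.\<close>
      have "(\<Sum>j<i. 4 * lam j) \<le> (\<Sum>j<i. h i j + h j i)"
      proof (rule sum_mono)
        fix j assume j: "j \<in> {..<i}"
        have "min (lam i) (lam j) = lam j" using mono[of j i] j True by simp
        then show "4 * lam j \<le> h i j + h j i"
          using card_inv_pairs_off_diag[of i j] card_inv_pairs_swap[of j i] j i True e[of i] e[of j] by (simp add: h_def)
      qed
      moreover have "2 * g i = (\<Sum>j<i. 4 * lam j)" using True by (simp add: g_def sum_distrib_left)
      ultimately show ?thesis by simp
    qed (simp add: g_def)
    moreover have "2 * (lam i - 1) \<le> h i i" unfolding h_def by (rule card_inv_pairs_diag[OF i])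
    ultimately show ?thesis by simp
  qed
  then have "(\<Sum>i<z. 2 * (lam i - 1) + 2 * g i) \<le> (\<Sum>i<z. h i i + (\<Sum>j<i. h i j + h j i))"
    by (intro sum_mono) auto
  moreover have "(\<Sum>i<z. g i) = (\<Sum>i<m. \<Sum>j<i. 2 * lam j)"
  proof -
    have "(\<Sum>i<z. g i) = (\<Sum>i<m. g i)" using m by (intro sum.mono_neutral_right) (auto simp: g_def)
    then show ?thesis by (simp add: g_def)
  qed
  moreover have "(\<Sum>i<z. 2 * (lam i - 1) + 2 * g i) = 2 * (\<Sum>i<z. lam i - 1) + 2 * (\<Sum>i<z. g i)"
    by (simp add: sum.distrib sum_distrib_left)
  ultimately show ?thesis using up by linarith
qed

text \<open>Along a negative cycle the heights are antiperiodic, so some positive vector of its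
  orbit becomes negative. Disjoint orbits give distinct vectors.\<close>

lemma card_Sigma_ge:
  assumes m: "m \<le> z" and e: "\<And>i. i < m \<Longrightarrow> eps i = - 1"
  shows "m \<le> card (Sigma_short w)"
proof -
  have "\<exists>v. v \<in> orb i \<inter> Sigma_short w" if "i < m" for i
  proof -
    have i: "i < z" using that m by simp
    have bb: "b i \<in> orb i" using orb_base[OF i] .
    let ?f = "\<lambda>k. rho ((w ^^ k) (b i))"
    have "?f (k + lam i) = - ?f k" for k
      using period[OF i] e[OF that] by (simp add: funpow_add pow_neg rho_minus)
    then obtain k where "?f k > 0" "?f (Suc k) < 0"
      using descent_antiperiodic[of ?f "lam i"] rho_nz[OF pow_mem[OF base[OF i]]] by blast
    then show ?thesis using orb_pow[OF i bb, of k] orb_sub[OF i] by (intro exI[of _ "(w ^^ k) (b i)"]) (auto simp: Sigma_eq[OF w_W])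
  qed
  then obtain v where v: "\<And>i. i < m \<Longrightarrow> v i \<in> orb i \<inter> Sigma_short w" by metis
  have "inj_on v {..<m}"
  proof (rule inj_onI, rule ccontr)
    fix i j assume "i \<in> {..<m}" "j \<in> {..<m}" "v i = v j" "i \<noteq> j"
    then show False using v[of i] v[of j] orb_disjoint[of i j] m by auto
  qed
  moreover have "finite (Sigma_short w)" by (simp add: Sigma_eq[OF w_W] finite_signed_basis)
  ultimately show ?thesis using card_inj_on_le[of v "{..<m}" "Sigma_short w"] v by auto
qed

end

section \<open>Conjugacy and signed cycle types\<close>

text \<open>The intertwining relation passes to all powers, so the images of the starting vectors
  under \<open>g\<close> have the same periods and signs. Lower bounds stated in terms of
  \<open>lam\<close> and \<open>eps\<close> therefore hold for every conjugate.\<close>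

lemma (in orbit_system) orbit_system_transport:
  assumes g: "g \<in> carrier W" and y: "y \<in> carrier W" "y \<circ> g = g \<circ> w"
  shows "orbit_system y z (g \<circ> b) lam eps"
proof -
  have pow: "(y ^^ k) (g x) = g ((w ^^ k) x)" for k x
    using y(2) by (induction k) (simp_all add: fun_eq_iff)
  have lin: "g (s *\<^sub>R x) = s *\<^sub>R g x" for s x
    using linear_scale[OF W_linear[OF g]] .
  have "bij_betw g signed_basis signed_basis"
    using W_image[OF g] W_bij[OF g] by (metis bij_betw_def inj_on_subset subset_UNIV)
  from bij_betw_trans[OF bij this]
  have "bij_betw (\<lambda>(s, i, k). s *\<^sub>R (y ^^ k) ((g \<circ> b) i)) ({1, - 1} \<times> (SIGMA i:{..<z}. {..<lam i})) signed_basis"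
    by (simp add: comp_def split_def pow lin)
  then show ?thesis
    using y(1) W_mem[OF g] base lam_pos eps period
    by unfold_locales (auto simp: pow lin)
qed

text \<open>Sending each iterate of \<open>b i\<close> under \<open>x\<close> to the same iterate of
  \<open>b' i\<close> under \<open>y\<close> matches the two systems, and the common periods and
  signs make this compatible with the maps.\<close>

lemma orbit_system_conj:
  fixes x y :: "('n::{finite,linorder}) endo"
  assumes "orbit_system x z b lam eps" "orbit_system y z b' lam eps"
  obtains g where "g \<in> carrier W" "y \<circ> g = g \<circ> x"
proof -
  interpret x: orbit_system x z b lam eps by fact
  interpret y: orbit_system y z b' lam eps by fact
  let ?K = "SIGMA i:{..<z}. {..<lam i}"
  \<comment> \<open>The iterates with s = 1 form an orthonormal basis, so inner products are the
    coordinates of \<open>v\<close> and the formula is the linear extension of the matching.\<close>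
  define g where "g v = (\<Sum>p\<in>?K. (v \<bullet> (x ^^ snd p) (b (fst p))) *\<^sub>R (y ^^ snd p) (b' (fst p)))" for v
  have lin: "linear g"
    by (rule linearI) (simp_all add: g_def inner_add_left scaleR_add_left sum.distrib scaleR_sum_right)
  have g: "g ((x ^^ k) (b i)) = (y ^^ k) (b' i)" if ik: "i < z" "k < lam i" for i k
  proof -
    have "((x ^^ k) (b i)) \<bullet> (x ^^ snd p) (b (fst p)) = (if p = (i, k) then 1 else 0)" if p: "p \<in> ?K" for p
    proof -
      obtain i' k' where p': "p = (i', k')" "i' < z" "k' < lam i'" using p by auto
      have B: "(x ^^ k) (b i) \<in> signed_basis" "(x ^^ k') (b i') \<in> signed_basis"
        using x.pow_mem x.base ik p' by auto
      show ?thesis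
        using x.index_unique[of 1 k i 1 k' i'] x.index_unique[of 1 k i "- 1" k' i'] p' ik
        by (auto simp: signed_basis_inner[OF B])
    qed
    then have "g ((x ^^ k) (b i)) = (\<Sum>p\<in>?K. if p = (i, k) then (y ^^ snd p) (b' (fst p)) else 0)"
      unfolding g_def by (intro sum.cong) auto
    also have "\<dots> = (y ^^ k) (b' i)" using ik by (subst sum.delta) auto
    finally show ?thesis .
  qed
  have gs: "g (s *\<^sub>R (x ^^ k) (b i)) = s *\<^sub>R (y ^^ k) (b' i)" if "i < z" "k < lam i" for s i k
    using g[OF that] linear_scale[OF lin] by simp
  have "g ` signed_basis = g ` (\<lambda>(s, i, k). s *\<^sub>R (x ^^ k) (b i)) ` ({1, - 1} \<times> ?K)"
    using bij_betw_imp_surj_on[OF x.bij] by simp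
  also have "\<dots> = (\<lambda>(s, i, k). s *\<^sub>R (y ^^ k) (b' i)) ` ({1, - 1} \<times> ?K)"
    unfolding image_image by (intro image_cong) (auto simp: gs linear_neg[OF lin] g)
  also have "\<dots> = signed_basis" by (rule bij_betw_imp_surj_on[OF y.bij])
  finally have gW: "g \<in> carrier W" using lin by (simp add: W_carrier)
  have "y \<circ> g = g \<circ> x"
  proof (rule linear_eq_signed_basis)
    fix v :: "(real, 'n) vec" assume "v \<in> signed_basis"
    then obtain i s k where v: "i < z" "s \<in> {1, - 1}" "k < lam i" "v = s *\<^sub>R (x ^^ k) (b i)"
      by (rule x.orb_cover)
    have "y (g v) = s *\<^sub>R (y ^^ Suc k) (b' i)"
      using v gs[of i k s] y.pow_scale[of 1] by simp
    moreover have "x v = s *\<^sub>R (x ^^ Suc k) (b i)" using v x.pow_scale[of 1] by simp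
    moreover have "g (s *\<^sub>R (x ^^ Suc k) (b i)) = s *\<^sub>R (y ^^ Suc k) (b' i)"
    proof (cases "Suc k < lam i")
      case False
      then have k: "Suc k = lam i" using v(3) by simp
      \<comment> \<open>At the end of a cycle both sides return to their starting vectors with the
        same factor \<open>eps i\<close>.\<close>
      have "g (b i) = b' i" using g[of i 0] v by simp
      then show ?thesis unfolding k x.period[OF v(1)] y.period[OF v(1)] by (simp add: linear_scale[OF lin])
    qed (rule gs[OF v(1)])
    ultimately show "(y \<circ> g) v = (g \<circ> x) v" by simp
  qed (simp_all add: linear_compose lin W_linear x.w_W y.w_W)
  with gW that show thesis by blast
qed

text \<open>Counting the vectors below recovers the number of cycles with given length and sign from the map alone.\<close>

definition first_return :: "('n::{finite,linorder}) endo \<Rightarrow> nat \<Rightarrow> real \<Rightarrow> (real, 'n) vec set" where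
  "first_return w k e = {v \<in> signed_basis. (w ^^ k) v = e *\<^sub>R v \<and>
     (\<forall>d. 0 < d \<and> d < k \<longrightarrow> (w ^^ d) v \<noteq> v \<and> (w ^^ d) v \<noteq> - v)}"

text \<open>Each vector of orbit i comes back to itself or its negative for the first time after
  \<open>lam i\<close> steps, with sign \<open>eps i\<close>. The set is thus the union of the
  orbits with these parameters, each having 2k vectors.\<close>

lemma (in orbit_system) card_first_return:
  assumes k: "0 < k" and e: "e \<in> {1, - 1}"
  shows "card (first_return w k e) = 2 * k * card {i. i < z \<and> lam i = k \<and> eps i = e}"
proof -
  let ?I = "{i. i < z \<and> lam i = k \<and> eps i = e}"
  have sign: "e = e'" if "e *\<^sub>R v = e' *\<^sub>R v" "v \<in> signed_basis" for e' v
    using that signed_basis_nz[OF that(2)] by simp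
  have "first_return w k e = (\<Union>i\<in>?I. orb i)"
  proof (intro equalityI subsetI)
    fix v assume v: "v \<in> first_return w k e"
    then have vB: "v \<in> signed_basis" by (simp add: first_return_def)
    then obtain i s m where ism: "i < z" "s \<in> {1, - 1}" "m < lam i" "v = s *\<^sub>R (w ^^ m) (b i)"
      by (rule orb_cover)
    then have vo: "v \<in> orb i" unfolding orb_def by (auto intro!: image_eqI[of _ _ "(s, m)"])
    have ret: "(w ^^ k) v = e *\<^sub>R v" and min: "\<And>d. 0 < d \<Longrightarrow> d < k \<Longrightarrow> (w ^^ d) v \<noteq> v \<and> (w ^^ d) v \<noteq> - v"
      using v by (auto simp: first_return_def)
    have per: "(w ^^ lam i) v = eps i *\<^sub>R v" by (rule period_orb[OF ism(1) vo])
    have "\<not> lam i < k"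
    proof
      assume "lam i < k"
      then have "eps i *\<^sub>R v \<noteq> v" "eps i *\<^sub>R v \<noteq> - v" using min[of "lam i"] lam_pos[OF ism(1)] per by auto
      then show False using eps[OF ism(1)] by auto
    qed
    moreover have "\<not> k < lam i"
    proof
      assume "k < lam i"
      then have "e *\<^sub>R v \<noteq> v" "e *\<^sub>R v \<noteq> - v" using pow_distinct[OF ism(1) k _ vo] ret by auto
      then show False using e by auto
    qed
    ultimately have "lam i = k" by simp
    then have "i \<in> ?I" using sign[OF _ vB, of "eps i"] per ret ism(1) by simp
    then show "v \<in> (\<Union>i\<in>?I. orb i)" using vo by blast
  next
    fix v assume "v \<in> (\<Union>i\<in>?I. orb i)"
    then obtain i where i: "i < z" "lam i = k" "eps i = e" "v \<in> orb i" by auto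
    then show "v \<in> first_return w k e"
      using orb_sub[OF i(1)] period_orb[OF i(1,4)] pow_distinct[OF i(1) _ _ i(4)]
      by (auto simp: first_return_def)
  qed
  also have "card \<dots> = (\<Sum>i\<in>?I. card (orb i))"
    using orb_disjoint finite_orb by (intro card_UN_disjoint) auto
  also have "\<dots> = (\<Sum>i\<in>?I. 2 * k)" using card_orb by (intro sum.cong) auto
  finally show ?thesis by simp
qed

lemma orbit_system_type_unique:
  assumes "orbit_system w z b lam eps" "orbit_system w z' b' lam' eps'" "0 < k" "e \<in> {1, - 1}"
  shows "card {i. i < z \<and> lam i = k \<and> eps i = e} = card {i. i < z' \<and> lam' i = k \<and> eps' i = e}"
  using orbit_system.card_first_return[OF assms(1,3,4)] orbit_system.card_first_return[OF assms(2,3,4)] assms(3)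
  by simp

section \<open>Products of disjoint signed cycles\<close>

lemma cycle_product_Cons: "cycle_product (c # cs) = cycle_map c \<circ> cycle_product cs"
  by (simp add: cycle_product_def)

lemma linear_cycle_product: "linear (cycle_product cs)"
proof (induction cs)
  case Nil
  then show ?case by (simp add: cycle_product_def linear_id[unfolded id_def] id_def)
next
  case (Cons c cs)
  then show ?case unfolding cycle_product_Cons by (rule linear_compose[OF _ linear_cycle_map])
qed

lemma cycle_product_other:
  fixes i :: nat
  assumes "\<forall>c \<in> set cs. is_signed_cycle CARD('n) c" "i \<in> {1..CARD('n)}" "i \<notin> idx ` set (concat cs)"
  shows "cycle_product cs (evec i :: (real, 'n::{finite,linorder}) vec) = evec i"
  using assms
proof (induction cs)
  case (Cons c cs)
  then have "cycle_product cs (evec i :: (real, 'n) vec) = evec i" by auto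
  then show ?case using Cons.prems cycle_map_other[of c i, where 'n='n] by (auto simp: cycle_product_Cons)
qed (simp add: cycle_product_def)

lemma cycle_idx_range:
  assumes "is_signed_cycle n c" "m < length c" shows "idx (c ! m) \<in> {1..n}"
  using assms nth_mem[of m c] unfolding is_signed_cycle_def by blast

text \<open>By disjointness of the supports, factors applied before c fix the given vector, and
  factors applied after c fix its image, whose index lies on c again.\<close>

lemma cycle_product_entry:
  assumes "\<forall>c \<in> set cs. is_signed_cycle CARD('n) c" "distinct (map idx (concat cs))"
    and "c \<in> set cs" "m < length c"
  shows "cycle_product cs (evec (idx (c ! m)) :: (real, 'n::{finite,linorder}) vec) =
    of_int (sgn (c ! m)) *\<^sub>R evec (idx (c ! (Suc m mod length c)))"
  using assms
proof (induction cs)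
  case (Cons d cs)
  have d: "is_signed_cycle CARD('n) d" and disj: "idx ` set d \<inter> idx ` set (concat cs) = {}"
    using Cons.prems by auto
  show ?case
  proof (cases "c \<in> set cs")
    case True
    then have IH: "cycle_product cs (evec (idx (c ! m)) :: (real, 'n) vec) =
        of_int (sgn (c ! m)) *\<^sub>R evec (idx (c ! (Suc m mod length c)))"
      using Cons by auto
    have l: "Suc m mod length c < length c" using Cons.prems(4) by (intro mod_less_divisor) auto
    then have "c ! (Suc m mod length c) \<in> set (concat cs)" using True nth_mem[OF l] unfolding set_concat by blast
    then have "idx (c ! (Suc m mod length c)) \<notin> idx ` set d" using disj by blast
    moreover have "idx (c ! (Suc m mod length c)) \<in> {1..CARD('n)}"
      using cycle_idx_range l Cons.prems(1,3) by blast
    ultimately have "cycle_map d (evec (idx (c ! (Suc m mod length c))) :: (real, 'n) vec) = evec (idx (c ! (Suc m mod length c)))"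
      using cycle_map_other[OF d] by blast
    then show ?thesis
      using IH by (simp add: cycle_product_Cons linear_scale[OF linear_cycle_map])
  next
    case False
    then have c: "c = d" using Cons.prems(3) by simp
    have "idx (c ! m) \<notin> idx ` set (concat cs)" using disj nth_mem[OF Cons.prems(4)] c by blast
    then have "cycle_product cs (evec (idx (c ! m)) :: (real, 'n) vec) = evec (idx (c ! m))"
      using cycle_product_other[of cs "idx (c ! m)", where 'n='n] cycle_idx_range[OF d, of m] Cons.prems c by auto
    then show ?thesis using cycle_map_entry[of d m, where 'n='n] d Cons.prems(4) c by (simp add: cycle_product_Cons)
  qed
qed simp

text \<open>The equation with an ordered product is replaced by conditions on single entries, which
  no longer mention the order of the cycles.\<close>

lemma is_cycle_decomposition_iff:
  "is_cycle_decomposition (w :: ('n::{finite,linorder}) endo) cs \<longleftrightarrow>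
     (\<forall>c \<in> set cs. is_signed_cycle CARD('n) c) \<and>
     distinct (map idx (concat cs)) \<and> idx ` set (concat cs) = {1..CARD('n)} \<and> linear w \<and>
     (\<forall>c \<in> set cs. \<forall>m < length c. w (evec (idx (c ! m))) =
        of_int (sgn (c ! m)) *\<^sub>R evec (idx (c ! (Suc m mod length c))))"
proof -
  have "w = cycle_product cs"
    if v: "\<forall>c \<in> set cs. is_signed_cycle CARD('n) c" "distinct (map idx (concat cs))"
      "idx ` set (concat cs) = {1..CARD('n)}" "linear w"
      and e: "\<forall>c \<in> set cs. \<forall>m < length c. w (evec (idx (c ! m))) =
        of_int (sgn (c ! m)) *\<^sub>R evec (idx (c ! (Suc m mod length c)))"
  proof (rule linear_eq_evec[OF v(4) linear_cycle_product])
    fix i assume "i \<in> {1..CARD('n)}"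
    then obtain k c where "c \<in> set cs" "k \<in> set c" "i = idx k"
      unfolding v(3)[symmetric] by auto
    then obtain m where "c \<in> set cs" "m < length c" "i = idx (c ! m)"
      by (metis in_set_conv_nth)
    then show "w (evec i) = cycle_product cs (evec i)"
      using e cycle_product_entry[OF v(1,2)] by simp
  qed
  then show ?thesis
    unfolding is_cycle_decomposition_def using cycle_product_entry linear_cycle_product by blast
qed

definition cycle_sign :: "int list \<Rightarrow> real" where
  "cycle_sign c = (if negative_cycle c then - 1 else 1)"

lemma prod_sgn_cycle_sign:
  assumes "\<forall>k \<in> set c. k \<noteq> 0"
  shows "(\<Prod>m<length c. of_int (sgn (c ! m)) :: real) = cycle_sign c"
proof -
  show ?thesis
    using assms
  proof (induction c)
    case (Cons k c)
    have "(\<Prod>m<length (k # c). of_int (sgn ((k # c) ! m)) :: real) = of_int (sgn k) * cycle_sign c"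
      using Cons by (simp add: prod.lessThan_Suc_shift del: prod.lessThan_Suc)
    then show ?case using Cons.prems by (auto simp: cycle_sign_def negative_cycle_def)
  qed (simp add: cycle_sign_def negative_cycle_def)
qed

text \<open>Starting from the first entry of a cycle, k steps lead to its entry number k, up to the
  product of the signs passed on the way. A full turn collects all signs, hence
  \<open>cycle_sign\<close>.\<close>

lemma decomposition_orbit_system:
  fixes w :: "('n::{finite,linorder}) endo"
  assumes dec: "is_cycle_decomposition w cs"
  shows "orbit_system w (length cs) (\<lambda>i. evec (idx (cs ! i ! 0))) (\<lambda>i. length (cs ! i)) (\<lambda>i. cycle_sign (cs ! i))"
proof -
  have valid: "\<And>c. c \<in> set cs \<Longrightarrow> is_signed_cycle CARD('n) c" and dist: "distinct (map idx (concat cs))"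
    and cover: "idx ` set (concat cs) = {1..CARD('n)}" and lin: "linear w"
    and step: "\<And>c m. c \<in> set cs \<Longrightarrow> m < length c \<Longrightarrow> w (evec (idx (c ! m))) =
        of_int (sgn (c ! m)) *\<^sub>R evec (idx (c ! (Suc m mod length c)))"
    using dec unfolding is_cycle_decomposition_iff by auto
  let ?s = "\<lambda>c k. \<Prod>m<k. of_int (sgn (c ! m)) :: real"
  have nz: "k \<noteq> 0" if "c \<in> set cs" "k \<in> set c" for c k
    using valid[OF that(1)] that(2) unfolding is_signed_cycle_def by fastforce
  have s: "?s c k \<in> {1, - 1}" if "c \<in> set cs" "k \<le> length c" for c k
    using that(2)
  proof (induction k)
    case (Suc k)
    then have "c ! k \<noteq> 0" using nz[OF that(1)] by simp
    then show ?case using Suc by (auto simp: sgn_if)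
  qed simp
  have pow: "(w ^^ k) (evec (idx (c ! 0))) = ?s c k *\<^sub>R evec (idx (c ! (k mod length c)))"
    if "c \<in> set cs" "k \<le> length c" for c k
    using that(2)
  proof (induction k)
    case (Suc k)
    then show ?case using step[OF that(1), of k] by (simp add: linear_scale[OF lin])
  qed simp
  have lenpos: "0 < length (cs ! i)" if "i < length cs" for i
    using valid[OF nth_mem[OF that]] by (simp add: is_signed_cycle_def)
  have full: "(w ^^ length c) (evec (idx (c ! 0))) = cycle_sign c *\<^sub>R evec (idx (c ! 0))" if "c \<in> set cs" for c
    using pow[OF that order_refl] prod_sgn_cycle_sign[of c] nz[OF that] by simp
  let ?f = "\<lambda>(s, i, k). s *\<^sub>R (w ^^ k) (evec (idx (cs ! i ! 0)))"
  let ?D = "{1, - 1 :: real} \<times> (SIGMA i:{..<length cs}. {..<length (cs ! i)})"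
  have rng: "evec (idx (c ! k)) \<in> (signed_basis :: (real, 'n) vec set)" if "c \<in> set cs" "k < length c" for c k
    using cycle_idx_range[OF valid[OF that(1)] that(2)] by (rule evec_signed_basis)
  have sub: "?f ` ?D \<subseteq> signed_basis"
  proof
    fix v assume "v \<in> ?f ` ?D"
    then obtain a i k where v: "a \<in> {1, - 1}" "i < length cs" "k < length (cs ! i)"
      "v = a *\<^sub>R (w ^^ k) (evec (idx (cs ! i ! 0)))" by auto
    then have "v = (a * ?s (cs ! i) k) *\<^sub>R evec (idx (cs ! i ! k))" using pow[of "cs ! i" k] by simp
    moreover have "a * ?s (cs ! i) k \<in> {1, - 1}" using v s[of "cs ! i" k] by auto
    ultimately show "v \<in> signed_basis" using rng[of "cs ! i" k] v by auto
  qed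
  have sup: "signed_basis \<subseteq> ?f ` ?D"
  proof
    fix v :: "(real, 'n) vec" assume "v \<in> signed_basis"
    then obtain a j where a: "a \<in> {1, - 1 :: real}" "j \<in> {1..CARD('n)}" "v = a *\<^sub>R evec j"
      by (elim signed_basisE) (metis insertCI scaleR_one, metis insertCI scaleR_minus1_left)
    then obtain l c where "c \<in> set cs" "l \<in> set c" "j = idx l"
      unfolding cover[symmetric] by auto
    then obtain i k where i: "i < length cs" "k < length (cs ! i)" "j = idx (cs ! i ! k)"
      by (metis in_set_conv_nth)
    let ?t = "?s (cs ! i) k"
    have t1: "?t \<in> {1, - 1}" using s[of "cs ! i" k] i by auto
    then have "v = ?f (a * ?t, i, k)" using a(3) i pow[of "cs ! i" k] by auto
    moreover have "(a * ?t, i, k) \<in> ?D" using a(1) t1 i by auto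
    ultimately show "v \<in> ?f ` ?D" by (rule image_eqI)
  qed
  \<comment> \<open>Both sides have 2n elements, so the surjection already established is a
    bijection.\<close>
  have "card ?D = 2 * (\<Sum>i<length cs. length (cs ! i))"
    by (simp add: card_cartesian_product)
  also have "(\<Sum>i<length cs. length (cs ! i)) = length (concat cs)"
    by (simp add: length_concat sum_list_sum_nth atLeast0LessThan)
  also have "\<dots> = card (set (map idx (concat cs)))" using distinct_card[OF dist] by simp
  also have "\<dots> = CARD('n)" using cover by simp
  finally have "card ?D = card (signed_basis :: (real, 'n) vec set)" by (simp add: card_signed_basis)
  then have bij: "bij_betw ?f ?D signed_basis"
    using sub sup eq_card_imp_inj_on[of ?D ?f] by (simp add: bij_betw_def subset_antisym)
  \<comment> \<open>A decomposition provides only a linear map; that \<open>w\<close> belongs to the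
    group follows by giving each signed basis vector a preimage among them and comparing
    cardinalities.\<close>
  have "signed_basis \<subseteq> w ` signed_basis"
  proof
    fix v :: "(real, 'n) vec" assume "v \<in> signed_basis"
    then have "v \<in> ?f ` ?D" using sup by blast
    then obtain a i k where v: "a \<in> {1, - 1}" "i < length cs" "k < length (cs ! i)"
      "v = a *\<^sub>R (w ^^ k) (evec (idx (cs ! i ! 0)))" by auto
    show "v \<in> w ` signed_basis"
    proof (cases k)
      case 0
      let ?c = "cs ! i"
      have ci: "?c \<in> set cs" using v by simp
      \<comment> \<open>The last vector of the cycle is mapped to the starting vector up to the sign
        of the cycle; a second factor \<open>cycle_sign\<close> cancels that sign.\<close>
      let ?p = "(w ^^ (length ?c - 1)) (evec (idx (?c ! 0)))"
      have "?f (1, i, length ?c - 1) \<in> signed_basis" using v(2,3) by (intro subsetD[OF sub] imageI) auto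
      then have "?p \<in> signed_basis" by simp
      moreover have "a * cycle_sign ?c \<in> {1, - 1}" using v(1) by (auto simp: cycle_sign_def)
      ultimately have "(a * cycle_sign ?c) *\<^sub>R ?p \<in> signed_basis" by auto
      moreover have "w ?p = cycle_sign ?c *\<^sub>R evec (idx (?c ! 0))"
        using full[OF ci] lenpos[OF v(2)] by (metis One_nat_def Suc_pred comp_apply funpow.simps(2))
      then have "v = w ((a * cycle_sign ?c) *\<^sub>R ?p)"
        using v(1,4) 0 by (auto simp: linear_scale[OF lin] linear_neg[OF lin] cycle_sign_def)
      ultimately show ?thesis by blast
    next
      case (Suc m)
      have "?f (a, i, m) \<in> signed_basis" using v Suc by (intro subsetD[OF sub] imageI) auto
      moreover have "v = w (?f (a, i, m))" using v Suc by (simp add: linear_scale[OF lin])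
      ultimately show ?thesis by blast
    qed
  qed
  moreover have "card (w ` signed_basis) \<le> card (signed_basis :: (real, 'n) vec set)"
    by (rule card_image_le[OF finite_signed_basis])
  ultimately have "w ` signed_basis = signed_basis"
    using card_seteq[of "w ` signed_basis" "signed_basis"] finite_imageI[OF finite_signed_basis, of w] by simp
  then have wW: "w \<in> carrier W" using lin by (simp add: W_carrier)
  show ?thesis
    using wW bij lenpos rng full by unfold_locales (auto simp: cycle_sign_def)
qed

section \<open>Conjugacy in \<open>W\<close> and the invariance of the cycle type\<close>

lemma W_inv: "g \<in> carrier W \<Longrightarrow> inv\<^bsub>W\<^esub> g \<in> carrier W \<and> inv\<^bsub>W\<^esub> g \<circ> g = id \<and> g \<circ> inv\<^bsub>W\<^esub> g = id"
  using group.l_inv[OF group_W, of g] group.r_inv[OF group_W, of g] group.inv_closed[OF group_W, of g] by simp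

text \<open>Conjugacy as an intertwining relation, so that later arguments compose maps with hardly
  any inverses.\<close>

lemma conj_class_W_iff:
  assumes x: "x \<in> carrier W"
  shows "y \<in> conj_class W x \<longleftrightarrow> y \<in> carrier W \<and> (\<exists>g \<in> carrier W. y \<circ> g = g \<circ> x)"
proof
  assume "y \<in> conj_class W x"
  then obtain g where g: "g \<in> carrier W" "y = g \<circ> x \<circ> inv\<^bsub>W\<^esub> g" by (auto simp: conj_class_def)
  then have "y \<circ> g = g \<circ> x" using W_inv[OF g(1)] by (simp add: comp_assoc)
  moreover have "y \<in> carrier W" using g W_comp W_inv x by metis
  ultimately show "y \<in> carrier W \<and> (\<exists>g \<in> carrier W. y \<circ> g = g \<circ> x)" using g by blast
next
  assume "y \<in> carrier W \<and> (\<exists>g \<in> carrier W. y \<circ> g = g \<circ> x)"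
  then obtain g where g: "g \<in> carrier W" "y \<circ> g = g \<circ> x" by blast
  then have "y = g \<circ> x \<circ> inv\<^bsub>W\<^esub> g" using W_inv[OF g(1)] by (metis comp_assoc comp_id)
  then show "y \<in> conj_class W x" using g(1) by (auto simp: conj_class_def)
qed

lemma conj_class_W_self: "x \<in> carrier W \<Longrightarrow> x \<in> conj_class W x"
  unfolding conj_class_W_iff by (auto intro!: bexI[of _ id] simp: W_carrier linear_id)

text \<open>Forgetting signs, \<open>w\<close> permutes the indices. The cycles of this permutation,
  with the sign of each image attached to its source, form the decomposition.\<close>

lemma decomposition_exists:
  fixes w :: "('n::{finite,linorder}) endo"
  assumes w: "w \<in> carrier W"
  obtains cs where "is_cycle_decomposition w cs"
proof -
  let ?N = "{1..CARD('n)}"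
  have "\<exists>j s. j \<in> ?N \<and> s \<in> {1, - 1 :: int} \<and> w (evec i) = of_int s *\<^sub>R evec j" if i: "i \<in> ?N" for i
  proof -
    from W_mem[OF w evec_signed_basis[OF i]] show ?thesis
    proof (cases rule: signed_basisE)
      case (1 j)
      then show ?thesis by (intro exI[of _ j] exI[of _ 1]) simp
    next
      case (2 j)
      then show ?thesis by (intro exI[of _ j] exI[of _ "- 1"]) simp
    qed
  qed
  then obtain p \<sigma> where p: "\<And>i. i \<in> ?N \<Longrightarrow> p i \<in> ?N"
    and \<sigma>: "\<And>i. i \<in> ?N \<Longrightarrow> \<sigma> i \<in> {1, - 1 :: int}"
    and wp: "\<And>i. i \<in> ?N \<Longrightarrow> w (evec i) = of_int (\<sigma> i) *\<^sub>R evec (p i)" by metis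
  have inj: "inj_on p ?N"
  proof (rule inj_onI)
    fix i j assume ij: "i \<in> ?N" "j \<in> ?N" "p i = p j"
    then have "w (evec i) = w (evec j) \<or> w (evec i) = w (- evec j)"
      using wp[of i] wp[of j] \<sigma>[of i] \<sigma>[of j] linear_neg[OF W_linear[OF w], of "evec j"] by auto
    then have "evec i = (evec j :: (real, 'n) vec) \<or> evec i = - (evec j :: (real, 'n) vec)"
      using W_bij[OF w] by (metis bij_def injD)
    moreover have "rho (evec i :: (real, 'n) vec) > 0" "rho (evec j :: (real, 'n) vec) > 0"
      using rho_evec_pos[OF ij(1)] rho_evec_pos[OF ij(2)] by blast+
    then have "evec i \<noteq> - (evec j :: (real, 'n) vec)" by (auto simp: rho_minus)
    ultimately show "i = j" using evec_eq_iff[OF ij(1,2)] by blast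
  qed
  \<comment> \<open>Extended by the identity, because a permutation of all natural numbers is
    required.\<close>
  define \<pi> where "\<pi> i = (if i \<in> ?N then p i else i)" for i
  have inj': "inj_on \<pi> ?N" using inj inj_on_cong[of ?N \<pi> p] by (simp add: \<pi>_def)
  have "\<pi> ` ?N \<subseteq> ?N"
  proof
    fix j assume "j \<in> \<pi> ` ?N"
    then obtain i where i: "i \<in> ?N" "j = \<pi> i" by blast
    then have "\<pi> i = p i" by (simp add: \<pi>_def)
    then show "j \<in> ?N" using p[OF i(1)] i(2) by (simp only:)
  qed
  then have "bij_betw \<pi> ?N ?N"
    using inj' endo_inj_surj[OF finite_atLeastAtMost] by (simp add: bij_betw_def)
  then have perm: "\<pi> permutes ?N" by (rule bij_imp_permutes) (auto simp: \<pi>_def)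
  then have P: "permutation \<pi>" using permutation_permutes by blast
  \<comment> \<open>\<open>S a\<close> lists the cycle through a in the form a,
    \<open>\<pi> a\<close>, ..., starting at a.\<close>
  define S where "S = support \<pi>"
  have lenS: "length (S a) = least_power \<pi> a" and nthS: "k < length (S a) \<Longrightarrow> S a ! k = (\<pi> ^^ k) a"
    and distS: "distinct (S a)" for a k
    using cycle_of_permutation[OF P, of a] by (simp_all add: S_def)
  have self: "a \<in> set (S a)" for a
    using nth_mem[of 0 "S a"] nthS[of 0 a] least_power_of_permutation(2)[OF P, of a] lenS[of a] by simp
  have same: "set (S x) = set (S a)" if "x \<in> set (S a)" for x a
  proof (rule ccontr)
    assume ne: "set (S x) \<noteq> set (S a)"
    have "pairwise disjnt (range (\<lambda>y. set (S y)))"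
      using disjoint_support[OF P] by (simp only: S_def)
    then have "disjnt (set (S x)) (set (S a))"
      by (rule pairwiseD) (use ne in auto)
    then have "set (S x) \<inter> set (S a) = {}" unfolding disjnt_def .
    then show False using that self[of x] by blast
  qed
  have SN: "set (S a) \<subseteq> ?N" if "a \<in> ?N" for a
    using permutes_in_funpow_image[OF perm that] nthS[of _ a] by (auto simp: in_set_conv_nth)
  define cyc where "cyc a = map (\<lambda>i. \<sigma> i * int i) (S a)" for a
  have idx: "idx (\<sigma> i * int i) = i" "sgn (\<sigma> i * int i) = \<sigma> i" if "i \<in> ?N" for i
    using \<sigma>[OF that] that by (auto simp: abs_mult sgn_mult)
  have mapidx: "map idx (cyc a) = S a" if "a \<in> ?N" for a
    unfolding cyc_def map_map using SN[OF that] idx(1) by (intro map_idI) auto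
  \<comment> \<open>The minimum of each cycle serves as its representative, so each cycle is listed
    once.\<close>
  define R where "R = {a \<in> ?N. a = Min (set (S a))}"
  have finR: "finite R" by (simp add: R_def)
  define cs where "cs = map cyc (sorted_list_of_set R)"
  have RN: "a \<in> ?N" if "a \<in> R" for a using that by (simp add: R_def)
  have setcs: "set cs = cyc ` R" using finR by (simp add: cs_def)
  have mapcs: "map idx (concat cs) = concat (map S (sorted_list_of_set R))"
    unfolding cs_def map_concat map_map using mapidx RN finR by (intro arg_cong[of _ _ concat] map_cong) auto
  have valid: "is_signed_cycle CARD('n) c" if c: "c \<in> set cs" for c
  proof -
    obtain a where a: "c = cyc a" "a \<in> ?N" using c RN setcs by auto
    have "c \<noteq> []" using self[of a] by (auto simp: a(1) cyc_def)
    moreover have "distinct (map idx c)"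
      unfolding a(1) mapidx[OF a(2)] using distS by blast
    moreover have "idx ` set c = set (S a)" using mapidx[OF a(2)] unfolding a(1) by (metis set_map)
    ultimately show ?thesis unfolding is_signed_cycle_def using SN[OF a(2)] by simp
  qed
  have inter: "a = a'" if "a \<in> R" "a' \<in> R" "x \<in> set (S a)" "x \<in> set (S a')" for a a' x
    using that same[of x a] same[of x a'] unfolding R_def by (metis (mono_tags, lifting) mem_Collect_eq)
  have dist: "distinct (map idx (concat cs))"
    unfolding mapcs
  proof (rule distinct_concat)
    show "distinct (map S (sorted_list_of_set R))"
      unfolding distinct_map
    proof (intro conjI inj_onI)
      fix a a' assume a: "a \<in> set (sorted_list_of_set R)" "a' \<in> set (sorted_list_of_set R)" "S a = S a'"
      then have "a \<in> set (S a')" using self[of a] by (simp only:)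
      then show "a = a'" using inter[OF _ _ self[of a]] a(1,2) finR by simp
    qed simp
  next
    fix ys assume "ys \<in> set (map S (sorted_list_of_set R))"
    then obtain a where "ys = S a" by auto
    then show "distinct ys" using distS by blast
  next
    fix ys zs assume "ys \<in> set (map S (sorted_list_of_set R))" "zs \<in> set (map S (sorted_list_of_set R))" "ys \<noteq> zs"
    then obtain a a' where "a \<in> R" "a' \<in> R" "ys = S a" "zs = S a'" "a \<noteq> a'" using finR by auto
    then show "set ys \<inter> set zs = {}" using inter by blast
  qed
  have cover: "idx ` set (concat cs) = ?N"
  proof -
    have "idx ` set (concat cs) = (\<Union>a\<in>R. set (S a))"
      using arg_cong[OF mapcs, of set] finR by simp
    also have "\<dots> = ?N"
    proof (intro equalityI subsetI)
      fix i assume i: "i \<in> ?N"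
      define a where "a = Min (set (S i))"
      have "a \<in> set (S i)" unfolding a_def using self[of i] by (intro Min_in) auto
      then have "set (S a) = set (S i)" "a \<in> ?N" using same SN[OF i] by auto
      then have "a \<in> R" "i \<in> set (S a)" using self[of i] by (auto simp: R_def a_def)
      then show "i \<in> (\<Union>a\<in>R. set (S a))" by blast
    qed (use SN RN in blast)
    finally show ?thesis .
  qed
  have "w (evec (idx (c ! m))) = of_int (sgn (c ! m)) *\<^sub>R evec (idx (c ! (Suc m mod length c)))"
    if c: "c \<in> set cs" "m < length c" for c m
  proof -
    obtain a where a: "c = cyc a" "a \<in> ?N" using c RN setcs by auto
    have len: "length c = least_power \<pi> a" using a by (simp add: cyc_def lenS)
    have N: "(\<pi> ^^ k) a \<in> ?N" for k using permutes_in_funpow_image[OF perm a(2)] .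
    have nth: "c ! k = \<sigma> ((\<pi> ^^ k) a) * int ((\<pi> ^^ k) a)" if "k < length c" for k
      using that unfolding a(1) by (simp add: cyc_def nthS)
    \<comment> \<open>The length is the least period of a, so the cyclic successor of the last entry
      is again an iterate of \<open>\<pi>\<close>.\<close>
    have "(\<pi> ^^ (Suc m mod length c)) a = (\<pi> ^^ Suc m) a"
      using funpow_mod_eq[OF least_power_of_permutation(1)[OF P, of a]] len by simp
    moreover have "Suc m mod length c < length c" using c(2) by (intro mod_less_divisor) auto
    ultimately have "idx (c ! (Suc m mod length c)) = (\<pi> ^^ Suc m) a"
      using nth idx(1)[OF N[of "Suc m"]] by simp
    also have "\<dots> = p ((\<pi> ^^ m) a)" using N[of m] by (simp add: \<pi>_def)
    finally show ?thesis
      using nth[OF c(2)] idx[OF N[of m]] wp[OF N[of m]] by simp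
  qed
  then have "is_cycle_decomposition w cs"
    unfolding is_cycle_decomposition_iff using valid dist cover W_linear[OF w] by blast
  then show thesis by (rule that)
qed

lemma count_filter_length:
  "count (mset (map length (filter P cs))) k = card {i. i < length cs \<and> length (cs ! i) = k \<and> P (cs ! i)}"
proof -
  have "count (mset (map length (filter P cs))) k = length (filter (\<lambda>c. length c = k \<and> P c) cs)"
    by (induction cs) auto
  then show ?thesis by (simp add: length_filter_conv_card)
qed

text \<open>Both decompositions yield orbit systems for \<open>y\<close>, the first one after
  transport by \<open>g\<close>, and first returns count their cycles of given length and sign. The
  length 0 is treated apart: that count covers positive lengths, and no cycle is empty.\<close>

lemma decomposition_type_unique:
  assumes dec: "is_cycle_decomposition w cs" "is_cycle_decomposition y ds"
    and g: "g \<in> carrier W" "y \<circ> g = g \<circ> w"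
  shows "mset (map length (filter negative_cycle cs)) = mset (map length (filter negative_cycle ds))"
    and "mset (map length (filter (\<lambda>c. \<not> negative_cycle c) cs)) =
      mset (map length (filter (\<lambda>c. \<not> negative_cycle c) ds))"
proof -
  note sys = decomposition_orbit_system[OF dec(1)] decomposition_orbit_system[OF dec(2)]
  have y: "y \<in> carrier W" using sys(2) by (simp add: orbit_system_def)
  have eq: "card {i. i < length cs \<and> length (cs ! i) = k \<and> cycle_sign (cs ! i) = e} =
      card {i. i < length ds \<and> length (ds ! i) = k \<and> cycle_sign (ds ! i) = e}"
    if "0 < k" "e \<in> {1, - 1}" for k e
    using orbit_system_type_unique[OF orbit_system.orbit_system_transport[OF sys(1) g(1) y g(2)] sys(2) that] .
  have ne: "length (xs ! i) \<noteq> 0" if "is_cycle_decomposition x xs" "i < length xs" for i x and xs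
    using that nth_mem[OF that(2)] unfolding is_cycle_decomposition_def is_signed_cycle_def by auto
  have "count (mset (map length (filter negative_cycle cs))) k = count (mset (map length (filter negative_cycle ds))) k" for k
  proof (cases "k = 0")
    case True
    have "{i. i < length cs \<and> length (cs ! i) = k \<and> negative_cycle (cs ! i)} = {}"
      "{i. i < length ds \<and> length (ds ! i) = k \<and> negative_cycle (ds ! i)} = {}"
      using True ne[OF dec(1)] ne[OF dec(2)] by auto
    then show ?thesis unfolding count_filter_length by (simp only:)
  next
    case False
    have "(cycle_sign c = - 1) = negative_cycle c" for c by (simp add: cycle_sign_def)
    then show ?thesis using eq[of k "- 1"] False unfolding count_filter_length by simp
  qed
  then show "mset (map length (filter negative_cycle cs)) = mset (map length (filter negative_cycle ds))"
    by (intro multiset_eqI)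
  have "count (mset (map length (filter (\<lambda>c. \<not> negative_cycle c) cs))) k =
      count (mset (map length (filter (\<lambda>c. \<not> negative_cycle c) ds))) k" for k
  proof (cases "k = 0")
    case True
    have "{i. i < length cs \<and> length (cs ! i) = k \<and> \<not> negative_cycle (cs ! i)} = {}"
      "{i. i < length ds \<and> length (ds ! i) = k \<and> \<not> negative_cycle (ds ! i)} = {}"
      using True ne[OF dec(1)] ne[OF dec(2)] by auto
    then show ?thesis unfolding count_filter_length by (simp only:)
  next
    case False
    have "(cycle_sign c = 1) = (\<not> negative_cycle c)" for c by (simp add: cycle_sign_def)
    then show ?thesis using eq[of k 1] False unfolding count_filter_length by simp
  qed
  then show "mset (map length (filter (\<lambda>c. \<not> negative_cycle c) cs)) =
      mset (map length (filter (\<lambda>c. \<not> negative_cycle c) ds))"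
    by (intro multiset_eqI)
qed

text \<open>The definite description is meaningful because any decomposition of any conjugate has
  the same multisets of lengths, and sorting a multiset has only one outcome.\<close>

lemma signed_cycle_type_eq:
  assumes x: "x \<in> carrier W" and dec: "is_cycle_decomposition x cs"
  shows "signed_cycle_type (conj_class W x) =
    (sort (map length (filter negative_cycle cs)), sort (map length (filter (\<lambda>c. \<not> negative_cycle c) cs)))"
  unfolding signed_cycle_type_def
proof (rule the_equality)
  show "case (sort (map length (filter negative_cycle cs)), sort (map length (filter (\<lambda>c. \<not> negative_cycle c) cs)))
    of (neg, pos) \<Rightarrow> \<exists>w \<in> conj_class W x. \<exists>cs. is_cycle_decomposition w cs \<and>
     neg = sort (map length (filter negative_cycle cs)) \<and>
     pos = sort (map length (filter (\<lambda>c. \<not> negative_cycle c) cs))"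
    using conj_class_W_self[OF x] dec by auto
next
  fix p assume "case p of (neg, pos) \<Rightarrow> \<exists>w \<in> conj_class W x. \<exists>cs. is_cycle_decomposition w cs \<and>
     neg = sort (map length (filter negative_cycle cs)) \<and>
     pos = sort (map length (filter (\<lambda>c. \<not> negative_cycle c) cs))"
  then obtain y ds where y: "y \<in> conj_class W x" "is_cycle_decomposition y ds"
    "p = (sort (map length (filter negative_cycle ds)), sort (map length (filter (\<lambda>c. \<not> negative_cycle c) ds)))"
    by (cases p) auto
  then obtain g where "g \<in> carrier W" "y \<circ> g = g \<circ> x" using conj_class_W_iff[OF x] by blast
  from decomposition_type_unique[OF dec y(2) this]
  have "sort (map length (filter negative_cycle ds)) = sort (map length (filter negative_cycle cs))"
    "sort (map length (filter (\<lambda>c. \<not> negative_cycle c) ds)) = sort (map length (filter (\<lambda>c. \<not> negative_cycle c) cs))"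
    by (auto intro!: properties_for_sort)
  then show "p = (sort (map length (filter negative_cycle cs)), sort (map length (filter (\<lambda>c. \<not> negative_cycle c) cs)))"
    using y(3) by simp
qed

lemma decomposition_reorder:
  assumes dec: "is_cycle_decomposition w cs" and m: "mset ds = mset cs"
  shows "is_cycle_decomposition w ds"
proof -
  have "mset (map idx (concat ds)) = mset (map idx (concat cs))"
    using m by (simp add: mset_concat flip: sum_mset_sum_list)
  then have "distinct (map idx (concat ds)) = distinct (map idx (concat cs))"
    by (rule mset_eq_imp_distinct_iff)
  moreover have "set ds = set cs" using m by (rule mset_eq_setD)
  ultimately show ?thesis using dec unfolding is_cycle_decomposition_iff set_concat by metis
qed

lemma orbit_system_cong:
  assumes "orbit_system w z b lam eps" "\<And>i. i < z \<Longrightarrow> lam' i = lam i" "\<And>i. i < z \<Longrightarrow> eps' i = eps i"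
  shows "orbit_system w z b lam' eps'"
proof -
  have "(SIGMA i:{..<z}. {..<lam' i}) = (SIGMA i:{..<z}. {..<lam i})" using assms(2) by auto
  then show ?thesis using assms unfolding orbit_system_def by simp
qed

text \<open>Cycles matched in length and sign give orbit systems with the same parameters, between
  which a conjugating element was constructed.\<close>

lemma conj_class_W_decompositions:
  assumes x: "is_cycle_decomposition x cs" and y: "is_cycle_decomposition y ds"
    and len: "map length cs = map length ds" and neg: "map negative_cycle cs = map negative_cycle ds"
  shows "y \<in> conj_class W x"
proof -
  have l: "length ds = length cs" using len map_eq_imp_length_eq by metis
  have eq: "length (cs ! i) = length (ds ! i)" "cycle_sign (cs ! i) = cycle_sign (ds ! i)" if "i < length cs" for i
    using len neg that l by (metis nth_map, metis nth_map cycle_sign_def)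
  note X = decomposition_orbit_system[OF x]
  note Y = decomposition_orbit_system[OF y, unfolded l]
  obtain g where "g \<in> carrier W" "y \<circ> g = g \<circ> x"
    using orbit_system_conj[OF X orbit_system_cong[OF Y]] eq by metis
  then show ?thesis
    using X Y by (subst conj_class_W_iff) (auto simp: orbit_system_def)
qed

section \<open>The element \<open>u\<^sub>C\<close>\<close>

text \<open>The assumptions isolate what makes the cycles of \<open>u C\<close> well formed. They
  are verified for actual classes in \<open>conj_class_normal_form\<close>, whose proof that
  \<open>u C\<close> lies in C itself relies on the results of this context.\<close>

context
  fixes C :: "(('n::{finite,linorder}) endo) set"
  assumes sum_lengths: "sum_list (cyc_lengths C) = CARD('n)"
    and lengths_pos: "l \<in> set (cyc_lengths C) \<Longrightarrow> 0 < l"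
begin

lemma mu_step:
  assumes "i < length (cyc_lengths C)"
  shows "mu C i = mu C (Suc i) + cyc_lengths C ! i" "mu C (Suc i) < mu C i"
proof -
  have le: "sum_list (take (Suc i) (cyc_lengths C)) \<le> CARD('n)"
    unfolding sum_lengths[symmetric] by (metis append_take_drop_id le_add1 sum_list_append)
  have "sum_list (take (Suc i) (cyc_lengths C)) = sum_list (take i (cyc_lengths C)) + cyc_lengths C ! i"
    using assms by (simp add: take_Suc_conv_app_nth)
  then show "mu C i = mu C (Suc i) + cyc_lengths C ! i" using le by (simp add: mu_def)
  then show "mu C (Suc i) < mu C i" using lengths_pos[OF nth_mem[OF assms]] by simp
qed

lemma mu_0: "mu C 0 = CARD('n)"
  and mu_end: "mu C (length (cyc_lengths C)) = 0"
  by (simp_all add: mu_def sum_lengths)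

lemma mu_antimono: assumes "i \<le> j" shows "mu C j \<le> mu C i"
proof -
  have "sum_list (take i (cyc_lengths C)) \<le> sum_list (take j (cyc_lengths C))"
    using assms by (metis le_add1 min.absorb1 sum_list_append take_add le_Suc_ex)
  then show ?thesis by (simp add: mu_def)
qed

lemma card_mu: "CARD('n) - mu C i = sum_list (take i (cyc_lengths C))"
proof -
  have "sum_list (take i (cyc_lengths C)) \<le> CARD('n)"
    unfolding sum_lengths[symmetric] by (metis append_take_drop_id le_add1 sum_list_append)
  then show ?thesis by (simp add: mu_def)
qed

text \<open>The indices fall into consecutive blocks descending from n; the least k with
  \<open>mu C k < j\<close> is nonzero because \<open>mu C 0\<close> is n. With list positions
  starting at 0, position i belongs to the cycle \<open>u_cycle C (Suc i)\<close>, whose block ends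
  at \<open>mu C i\<close>.\<close>

lemma mu_block:
  assumes "j \<in> {1..CARD('n)}"
  obtains i where "i < length (cyc_lengths C)" "mu C (Suc i) < j" "j \<le> mu C i"
proof -
  define k where "k = (LEAST k. mu C k < j)"
  have k: "mu C k < j" "k \<le> length (cyc_lengths C)"
    unfolding k_def using assms mu_end
    by (auto intro!: LeastI[of "\<lambda>k. mu C k < j" "length (cyc_lengths C)"] Least_le)
  then obtain i where i: "k = Suc i" using assms mu_0 by (cases k) auto
  have "\<not> mu C i < j" using not_less_Least[of i "\<lambda>k. mu C k < j"] i k_def by simp
  then show ?thesis using that[of i] k i by simp
qed

definition u_cycles :: "int list list" where
  "u_cycles = map (u_cycle C) [1 ..< length (cyc_lengths C) + 1]"

lemma length_u_cycles: "length u_cycles = length (cyc_lengths C)"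
  by (simp add: u_cycles_def del: upt_Suc)

lemma u_cycles_nth: "i < length (cyc_lengths C) \<Longrightarrow> u_cycles ! i = u_cycle C (Suc i)"
  by (simp add: u_cycles_def del: upt_Suc)

lemma idx_u_cycle:
  assumes "i < length (cyc_lengths C)"
  shows "map idx (u_cycle C (Suc i)) = [mu C (Suc i) + 1 ..< mu C i + 1]"
  using mu_step(2)[OF assms] by (simp add: u_cycle_def comp_def)

lemma length_u_cycle:
  assumes "i < length (cyc_lengths C)"
  shows "length (u_cycle C (Suc i)) = cyc_lengths C ! i"
  using arg_cong[OF idx_u_cycle[OF assms], of length] mu_step(1)[OF assms] by simp

lemma idx_u_cycle_nth:
  assumes "i < length (cyc_lengths C)" "m < cyc_lengths C ! i"
  shows "idx (u_cycle C (Suc i) ! m) = mu C (Suc i) + 1 + m"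
proof -
  have "idx (u_cycle C (Suc i) ! m) = map idx (u_cycle C (Suc i)) ! m"
    using assms by (simp add: length_u_cycle)
  also have "\<dots> = mu C (Suc i) + 1 + m"
    unfolding idx_u_cycle[OF assms(1)] using assms mu_step(1)[OF assms(1)] by (subst nth_upt) auto
  finally show ?thesis .
qed

lemma negative_u_cycle:
  assumes "i < length (cyc_lengths C)"
  shows "negative_cycle (u_cycle C (Suc i)) \<longleftrightarrow> i < nu C"
  using mu_step(2)[OF assms] by (auto simp: u_cycle_def negative_cycle_def filter_empty_conv)

lemma u_cycle_valid:
  assumes "i < length (cyc_lengths C)"
  shows "is_signed_cycle CARD('n) (u_cycle C (Suc i))"
proof -
  have "idx ` set (u_cycle C (Suc i)) = {mu C (Suc i) + 1 ..< mu C i + 1}"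
    using arg_cong[OF idx_u_cycle[OF assms], of set] by (simp del: upt_Suc)
  then show ?thesis
    unfolding is_signed_cycle_def idx_u_cycle[OF assms]
    using mu_antimono[of 0 i] mu_0 by (auto simp: u_cycle_def)
qed

text \<open>Blocks are removed from the top, so after k cycles exactly the indices above
  \<open>mu C k\<close> have been used.\<close>

lemma u_cycles_concat:
  assumes "k \<le> length (cyc_lengths C)"
  shows "distinct (map idx (concat (map (u_cycle C) [1 ..< k + 1])))
    \<and> idx ` set (concat (map (u_cycle C) [1 ..< k + 1])) = {mu C k + 1 .. CARD('n)}"
  using assms
proof (induction k)
  case 0
  then show ?case by (simp add: mu_0)
next
  case (Suc k)
  then have k: "k < length (cyc_lengths C)" by simp
  have s: "idx ` set (u_cycle C (Suc k)) = {mu C (Suc k) + 1 ..< mu C k + 1}"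
    using arg_cong[OF idx_u_cycle[OF k], of set] by (simp del: upt_Suc)
  have d: "distinct (map idx (u_cycle C (Suc k)))" unfolding idx_u_cycle[OF k] by simp
  have e: "concat (map (u_cycle C) [1 ..< Suc k + 1]) = concat (map (u_cycle C) [1 ..< k + 1]) @ u_cycle C (Suc k)"
    by simp
  have IH: "distinct (map idx (concat (map (u_cycle C) [1 ..< k + 1])))"
    "idx ` set (concat (map (u_cycle C) [1 ..< k + 1])) = {mu C k + 1 .. CARD('n)}"
    using Suc by auto
  have "distinct (map idx (concat (map (u_cycle C) [1 ..< Suc k + 1])))"
    unfolding e map_append distinct_append set_map IH(2) s using IH(1) d by auto
  moreover have "idx ` set (concat (map (u_cycle C) [1 ..< Suc k + 1])) = {mu C (Suc k) + 1 .. CARD('n)}"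
    unfolding e set_append image_Un IH(2) s using mu_step(2)[OF k] mu_antimono[of 0 k] mu_0 by auto
  ultimately show ?case by blast
qed

lemma u_decomposition: "is_cycle_decomposition (u C) u_cycles"
proof -
  have "is_signed_cycle CARD('n) c" if "c \<in> set u_cycles" for c
    using that u_cycle_valid u_cycles_nth length_u_cycles by (metis in_set_conv_nth)
  then show ?thesis
    using u_cycles_concat[of "length (cyc_lengths C)"] mu_end
    unfolding is_cycle_decomposition_def by (auto simp: u_def u_cycles_def simp del: upt_Suc)
qed

lemma u_evec_inner:
  assumes i: "i < length (cyc_lengths C)" and j: "mu C (Suc i) < j" "j < mu C i"
  shows "u C (evec j) = evec (Suc j)"
proof -
  \<comment> \<open>The list position of j in its cycle, whose first entry
    \<open>mu C (Suc i) + 1\<close> has position 0.\<close>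
  define m where "m = j - mu C (Suc i) - 1"
  have l: "length (u_cycle C (Suc i)) = mu C i - mu C (Suc i)"
    using length_u_cycle[OF i] mu_step[OF i] by simp
  have m: "j = mu C (Suc i) + 1 + m" "Suc m < length (u_cycle C (Suc i))" "Suc m < cyc_lengths C ! i"
    using j l length_u_cycle[OF i] by (auto simp: m_def)
  have mem: "u_cycle C (Suc i) \<in> set u_cycles"
    using u_cycles_nth[OF i] nth_mem[of i u_cycles] i by (simp add: length_u_cycles)
  have "u_cycle C (Suc i) ! m = int j"
    using m(2) j by (auto simp: u_cycle_def nth_append m_def)
  then have "sgn (u_cycle C (Suc i) ! m) = 1" "idx (u_cycle C (Suc i) ! m) = j" using j by auto
  moreover have "idx (u_cycle C (Suc i) ! Suc m) = Suc j"
    using idx_u_cycle_nth[OF i m(3)] m(1) by simp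
  ultimately show ?thesis
    using u_decomposition mem m(2) unfolding is_cycle_decomposition_iff
    by (metis Suc_lessD mod_less of_int_1 scaleR_one)
qed

lemma u_evec_last:
  assumes i: "i < length (cyc_lengths C)"
  shows "u C (evec (mu C i)) = (if i < nu C then - 1 else 1) *\<^sub>R evec (mu C (Suc i) + 1)"
proof -
  define m where "m = length (u_cycle C (Suc i)) - 1"
  have l: "length (u_cycle C (Suc i)) = mu C i - mu C (Suc i)"
    using length_u_cycle[OF i] mu_step[OF i] by simp
  have m: "m < length (u_cycle C (Suc i))" "Suc m = length (u_cycle C (Suc i))"
    using l mu_step(2)[OF i] by (auto simp: m_def)
  have mem: "u_cycle C (Suc i) \<in> set u_cycles"
    using u_cycles_nth[OF i] nth_mem[of i u_cycles] i by (simp add: length_u_cycles)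
  have "u_cycle C (Suc i) ! m = (if i < nu C then - int (mu C i) else int (mu C i))"
    unfolding m_def u_cycle_def by (auto simp: nth_append)
  then have "sgn (u_cycle C (Suc i) ! m) = (if i < nu C then - 1 else 1)" "idx (u_cycle C (Suc i) ! m) = mu C i"
    using mu_step(2)[OF i] by auto
  moreover have "idx (u_cycle C (Suc i) ! (Suc m mod length (u_cycle C (Suc i)))) = mu C (Suc i) + 1"
    using idx_u_cycle_nth[OF i, of 0] lengths_pos[OF nth_mem[OF i]] by (simp add: m(2))
  moreover have "u C (evec (idx (u_cycle C (Suc i) ! m))) = of_int (sgn (u_cycle C (Suc i) ! m)) *\<^sub>R
      evec (idx (u_cycle C (Suc i) ! (Suc m mod length (u_cycle C (Suc i)))))"
    using u_decomposition mem m(1) unfolding is_cycle_decomposition_iff by blast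
  ultimately show ?thesis by simp
qed

lemma u_carrier: "u C \<in> carrier W"
  using decomposition_orbit_system[OF u_decomposition] by (simp add: orbit_system_def)

lemma u_evec_block:
  assumes i: "i < length (cyc_lengths C)" and j: "mu C (Suc i) < j" "j \<le> mu C i"
  obtains j' where "mu C (Suc i) < j'" "j' \<le> mu C i"
    "u C (evec j) = (if j = mu C i \<and> i < nu C then - 1 else 1) *\<^sub>R evec j'"
proof (cases "j = mu C i")
  case True
  then show ?thesis using that[of "mu C (Suc i) + 1"] u_evec_last[OF i] mu_step(2)[OF i] by auto
next
  case False
  then show ?thesis using that[of "Suc j"] u_evec_inner[OF i j(1)] j by auto
qed

text \<open>Only the last entry of a negative cycle carries a minus sign, so at most one basis
  vector per negative block is made negative.\<close>

lemma card_Sigma_u_le: "nu C \<le> length (cyc_lengths C) \<Longrightarrow> card (Sigma_short (u C)) \<le> nu C"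
proof -
  assume nu: "nu C \<le> length (cyc_lengths C)"
  have "Sigma_short (u C) \<subseteq> (\<lambda>i. evec (mu C i)) ` {..<nu C}"
  proof
    fix v assume "v \<in> Sigma_short (u C)"
    then have v: "v \<in> signed_basis" "rho v > 0" "rho (u C v) < 0" by (auto simp: Sigma_eq[OF u_carrier])
    then obtain j where j: "j \<in> {1..CARD('n)}" "v = evec j" by (elim rho_pos_evec)
    then obtain i where i: "i < length (cyc_lengths C)" "mu C (Suc i) < j" "j \<le> mu C i" by (elim mu_block)
    then obtain j' where j': "mu C (Suc i) < j'" "j' \<le> mu C i"
      "u C (evec j) = (if j = mu C i \<and> i < nu C then - 1 else 1) *\<^sub>R evec j'" by (rule u_evec_block)
    have "j' \<in> {1..CARD('n)}" using j'(1,2) mu_antimono[of 0 i] mu_0 by auto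
    then have "rho (evec j' :: (real, 'n) vec) > 0" by (rule rho_evec_pos)
    then have "j = mu C i \<and> i < nu C" using v(3) j(2) j'(3) by (auto split: if_splits)
    then show "v \<in> (\<lambda>i. evec (mu C i)) ` {..<nu C}" using j(2) by auto
  qed
  then have "card (Sigma_short (u C)) \<le> card ((\<lambda>i. evec (mu C i) :: (real, 'n) vec) ` {..<nu C})"
    by (intro card_mono) auto
  also have "\<dots> \<le> nu C" using card_image_le[of "{..<nu C}"] by (metis card_lessThan finite_lessThan)
  finally show ?thesis .
qed

text \<open>The sign of a long root is that of its term with the smaller index. Inside a block an
  inversion must involve the top index, with a forced relative sign: this is \<open>A i\<close>,
  with length minus 1 elements. Across blocks the smaller index must be the top of a negative block,
  while the larger index and the sign are free: this is \<open>B i\<close>, with 2 (n -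
  \<open>mu C i\<close>) candidates, twice the total length of the earlier cycles.\<close>

lemma card_Lambda_u_le:
  assumes nu: "nu C \<le> length (cyc_lengths C)"
  shows "card (Lambda (u C)) \<le> (\<Sum>i<length (cyc_lengths C). cyc_lengths C ! i - 1)
    + (\<Sum>i<nu C. \<Sum>j<i. 2 * cyc_lengths C ! j)"
proof -
  let ?z = "length (cyc_lengths C)"
  define e :: "nat \<Rightarrow> real" where "e i = (if i < nu C then - 1 else 1)" for i
  define A :: "nat \<Rightarrow> (real, 'n) vec set" where
    "A i = (\<lambda>j. evec j + (- e i) *\<^sub>R evec (mu C i)) ` {mu C (Suc i)<..<mu C i}" for i
  define B :: "nat \<Rightarrow> (real, 'n) vec set" where
    "B i = (\<lambda>(s, j). evec (mu C i) + s *\<^sub>R evec j) ` ({1, - 1} \<times> {mu C i<..CARD('n)})" for i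
  have N: "j \<in> {1..CARD('n)}" if "mu C (Suc i) < j" "j \<le> mu C i" for i j
    using that mu_antimono[of 0 i] mu_0 by auto
  note lin = W_linear[OF u_carrier]
  have "Lambda (u C) \<subseteq> (\<Union>i<?z. A i) \<union> (\<Union>i<nu C. B i)"
  proof
    fix a assume a: "a \<in> Lambda (u C)"
    then have neg: "rho (u C a) < 0" unfolding Lambda_eq[OF u_carrier] by simp
    have "a \<in> Phi_long_pos" using a by (simp add: Lambda_def)
    then obtain j k and s :: real where jk: "1 \<le> j" "j < k" "k \<le> CARD('n)" "s \<in> {1, - 1}"
      and av: "a = evec j + s *\<^sub>R evec k"
      unfolding Phi_long_pos_def by force
    obtain i where i: "i < ?z" "mu C (Suc i) < j" "j \<le> mu C i" using mu_block[of j] jk by auto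
    obtain l where l: "l < ?z" "mu C (Suc l) < k" "k \<le> mu C l" using mu_block[of k] jk by auto
    have ua: "u C a = u C (evec j) + s *\<^sub>R u C (evec k)"
      by (simp add: av linear_add[OF lin] linear_scale[OF lin])
    show "a \<in> (\<Union>i<?z. A i) \<union> (\<Union>i<nu C. B i)"
    proof (cases "l = i")
      case True
      have kl: "k = mu C i"
      proof (rule ccontr)
        assume "k \<noteq> mu C i"
        then have "u C a = evec (Suc j) + s *\<^sub>R evec (Suc k)"
          using u_evec_inner[OF i(1)] i l True jk(2) by (simp add: ua)
        moreover have "Suc j \<in> {1..CARD('n)}" "Suc k \<in> {1..CARD('n)}"
          using N[of i "Suc k"] \<open>k \<noteq> mu C i\<close> i l True jk by auto
        ultimately have "rho (u C a) > 0"
          using jk by (auto simp: rho_add rho_minus rho_diff rho_evec)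
        then show False using neg by simp
      qed
      \<comment> \<open>The top index wraps around to the bottom of the block, below
        \<open>Suc j\<close>, so its coefficient decides the sign of the image.\<close>
      have "u C a = evec (Suc j) + (s * e i) *\<^sub>R evec (mu C (Suc i) + 1)"
        using u_evec_inner[OF i(1,2)] u_evec_last[OF i(1)] jk(2) kl by (simp add: ua e_def)
      moreover have "Suc j \<in> {1..CARD('n)}" "mu C (Suc i) + 1 \<in> {1..CARD('n)}"
        using N[of i "Suc j"] N[of i "mu C (Suc i) + 1"] i kl jk by auto
      moreover have "mu C (Suc i) + 1 < Suc j" using i by simp
      ultimately have "s * e i \<noteq> 1"
        using neg by (auto simp: rho_add rho_evec)
      then have "s = - e i" using jk(4) by (auto simp: e_def split: if_splits)
      then have "a \<in> A i" unfolding A_def using i jk(2) kl av by (intro image_eqI[of _ _ j]) auto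
      then show ?thesis using i(1) by blast
    next
      case False
      have "l < i"
      proof (rule ccontr)
        assume "\<not> l < i"
        then have "mu C l \<le> mu C (Suc i)" using False by (intro mu_antimono) simp
        then show False using i l jk(2) by simp
      qed
      then have il: "mu C i \<le> mu C (Suc l)" by (intro mu_antimono) simp
      obtain j' where j': "mu C (Suc i) < j'" "j' \<le> mu C i"
        "u C (evec j) = (if j = mu C i \<and> i < nu C then - 1 else 1) *\<^sub>R evec j'"
        using u_evec_block[OF i] .
      obtain k' where k': "mu C (Suc l) < k'" "k' \<le> mu C l"
        "u C (evec k) = (if k = mu C l \<and> l < nu C then - 1 else 1) *\<^sub>R evec k'"
        using u_evec_block[OF l] .
      have NN: "j' \<in> {1..CARD('n)}" "k' \<in> {1..CARD('n)}" using N j' k' by blast+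
      have lt: "j' < k'" using j' k' il by simp
      define r where "r = s * (if k = mu C l \<and> l < nu C then - 1 else 1)"
      have r: "r \<in> {1, - 1}" "s *\<^sub>R u C (evec k) = r *\<^sub>R evec k'"
        using k'(3) jk(4) by (auto simp: r_def)
      \<comment> \<open>Blocks are preserved, so the image of the smaller index stays below that of
        the larger one; the image can be negative only if \<open>u C\<close> negates
        \<open>evec j\<close>.\<close>
      have jj: "j = mu C i \<and> i < nu C"
      proof (rule ccontr)
        assume "\<not> (j = mu C i \<and> i < nu C)"
        then have "u C (evec j) = evec j'" using j'(3) by (simp only: if_False scaleR_one)
        then have "u C a = evec j' + r *\<^sub>R evec k'" using r(2) by (simp only: ua)
        then have "rho (u C a) > 0"
          using lt NN r(1) by (auto simp: rho_add rho_minus rho_diff rho_evec)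
        then show False using neg by simp
      qed
      then have "a \<in> B i" unfolding B_def using jk av by (intro image_eqI[of _ _ "(s, k)"]) auto
      then show ?thesis using jj by blast
    qed
  qed
  then have "card (Lambda (u C)) \<le> card ((\<Union>i<?z. A i) \<union> (\<Union>i<nu C. B i))"
    by (intro card_mono) (auto simp: A_def B_def)
  also have "\<dots> \<le> card (\<Union>i<?z. A i) + card (\<Union>i<nu C. B i)"
    by (rule card_Un_le)
  also have "card (\<Union>i<?z. A i) \<le> (\<Sum>i<?z. cyc_lengths C ! i - 1)"
  proof -
    have "card (\<Union>i<?z. A i) \<le> (\<Sum>i<?z. card (A i))" by (rule card_UN_le) simp
    also have "\<dots> \<le> (\<Sum>i<?z. cyc_lengths C ! i - 1)"
    proof (rule sum_mono)
      fix i assume "i \<in> {..<?z}"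
      then have "card {mu C (Suc i)<..<mu C i} = cyc_lengths C ! i - 1" using mu_step(1)[of i] by simp
      then show "card (A i) \<le> cyc_lengths C ! i - 1"
        unfolding A_def by (metis card_image_le finite_greaterThanLessThan)
    qed
    finally show ?thesis .
  qed
  also have "card (\<Union>i<nu C. B i) \<le> (\<Sum>i<nu C. \<Sum>j<i. 2 * cyc_lengths C ! j)"
  proof -
    have "card (\<Union>i<nu C. B i) \<le> (\<Sum>i<nu C. card (B i))" by (rule card_UN_le) simp
    also have "\<dots> \<le> (\<Sum>i<nu C. \<Sum>j<i. 2 * cyc_lengths C ! j)"
    proof (rule sum_mono)
      fix i assume i: "i \<in> {..<nu C}"
      have "card (B i) \<le> card ({1, - 1 :: real} \<times> {mu C i<..CARD('n)})"
        unfolding B_def by (rule card_image_le) simp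
      also have "\<dots> = 2 * (CARD('n) - mu C i)" by (simp add: card_cartesian_product)
      also have "\<dots> = 2 * (\<Sum>j<i. cyc_lengths C ! j)"
        unfolding card_mu using i nu by (simp add: sum_list_sum_nth atLeast0LessThan)
      finally show "card (B i) \<le> (\<Sum>j<i. 2 * cyc_lengths C ! j)" by (simp add: sum_distrib_left)
    qed
    finally show ?thesis .
  qed
  finally show ?thesis by simp
qed

end

section \<open>Normal form of a class and minimality of \<open>u C\<close>\<close>

lemma map_sort_key: "map f (sort_key f xs) = sort (map f xs)"
  by (rule properties_for_sort[symmetric]) simp_all

text \<open>Sorting whole cycles of \<open>x\<close> rather than only their lengths lets cycle i of
  \<open>x\<close> correspond to entry i of \<open>cyc_lengths C\<close>. The cycles of
  \<open>u C\<close> then match them in length and sign, which proves conjugacy and supplies the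
  orbit system in the order that the lower bound expects.\<close>

lemma conj_class_normal_form:
  fixes x :: "('n::{finite,linorder}) endo"
  assumes x: "x \<in> carrier W" and C: "C = conj_class W x"
  shows "sum_list (cyc_lengths C) = CARD('n)" and "\<And>l. l \<in> set (cyc_lengths C) \<Longrightarrow> 0 < l"
    and "nu C \<le> length (cyc_lengths C)"
    and "\<And>i j. i \<le> j \<Longrightarrow> j < nu C \<Longrightarrow> cyc_lengths C ! i \<le> cyc_lengths C ! j"
    and "u C \<in> C"
    and "\<exists>b. orbit_system x (length (cyc_lengths C)) b (\<lambda>i. cyc_lengths C ! i) (\<lambda>i. if i < nu C then - 1 else 1)"
proof -
  obtain cs where cs: "is_cycle_decomposition x cs" by (rule decomposition_exists[OF x])
  define ns ps where "ns = sort_key length (filter negative_cycle cs)"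
    and "ps = sort_key length (filter (\<lambda>c. \<not> negative_cycle c) cs)"
  define ds where "ds = ns @ ps"
  have "mset ds = mset cs" by (simp add: ds_def ns_def ps_def multiset_partition[symmetric])
  then have dec: "is_cycle_decomposition x ds" using decomposition_reorder[OF cs] by blast
  have type: "signed_cycle_type C = (map length ns, map length ps)"
    unfolding C signed_cycle_type_eq[OF x cs] by (simp add: ns_def ps_def map_sort_key)
  have L: "cyc_lengths C = map length ds" and N: "nu C = length ns"
    by (simp_all add: cyc_lengths_def nu_def type ds_def)
  have neg: "negative_cycle (ds ! i) \<longleftrightarrow> i < nu C" if "i < length ds" for i
  proof (cases "i < length ns")
    case True
    then have "ds ! i \<in> set ns" by (simp add: ds_def nth_append)
    then show ?thesis using True by (simp add: ns_def N)
  next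
    case False
    then have "ds ! i \<in> set ps" using that by (simp add: ds_def nth_append)
    then show ?thesis using False by (simp add: ps_def N)
  qed
  have "sum_list (cyc_lengths C) = length (concat ds)" by (simp add: L length_concat)
  also have "\<dots> = card (set (map idx (concat ds)))"
    using dec distinct_card[of "map idx (concat ds)"] by (simp add: is_cycle_decomposition_def)
  also have "\<dots> = CARD('n)" using dec by (simp add: is_cycle_decomposition_def)
  finally show sum: "sum_list (cyc_lengths C) = CARD('n)" .
  show pos: "0 < l" if "l \<in> set (cyc_lengths C)" for l
    using that dec by (auto simp: L is_cycle_decomposition_def is_signed_cycle_def)
  show "nu C \<le> length (cyc_lengths C)" by (simp add: L N ds_def)
  show "cyc_lengths C ! i \<le> cyc_lengths C ! j" if "i \<le> j" "j < nu C" for i j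
  proof -
    have "sorted (map length ns)" by (simp add: ns_def)
    then have "map length ns ! i \<le> map length ns ! j" using that by (intro sorted_nth_mono) (simp_all add: N)
    then show ?thesis using that by (simp add: L ds_def nth_append N)
  qed
  have "map length ds = map length (u_cycles C)"
    using length_u_cycles[OF sum pos] length_u_cycle[OF sum pos] u_cycles_nth[OF sum pos]
    by (intro nth_equalityI) (auto simp: L)
  moreover have "map negative_cycle ds = map negative_cycle (u_cycles C)"
    using length_u_cycles[OF sum pos] negative_u_cycle[OF sum pos] u_cycles_nth[OF sum pos] neg
    by (intro nth_equalityI) (auto simp: L)
  ultimately show "u C \<in> C"
    using conj_class_W_decompositions[OF dec u_decomposition[OF sum pos]] unfolding C by blast
  show "\<exists>b. orbit_system x (length (cyc_lengths C)) b (\<lambda>i. cyc_lengths C ! i) (\<lambda>i. if i < nu C then - 1 else 1)"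
  proof (rule exI, rule orbit_system_cong)
    show "orbit_system x (length (cyc_lengths C)) (\<lambda>i. evec (idx (ds ! i ! 0))) (\<lambda>i. length (ds ! i)) (\<lambda>i. cycle_sign (ds ! i))"
      using decomposition_orbit_system[OF dec] by (simp add: L)
  qed (use neg in \<open>auto simp: L cycle_sign_def\<close>)
qed

text \<open>The upper bound for \<open>u C\<close> and the lower bound for an arbitrary conjugate
  are the same expression in the cycle lengths. The orbit system of \<open>y\<close> is the one of
  \<open>x\<close> moved by the conjugating element.\<close>

lemma u_minimal:
  assumes x: "x \<in> carrier W" and C: "C = conj_class W x" and y: "y \<in> C"
  shows "card (Lambda (u C)) \<le> card (Lambda y)" "card (Sigma_short (u C)) \<le> card (Sigma_short y)"
proof -
  note nf = conj_class_normal_form[OF x C]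
  obtain g where g: "g \<in> carrier W" "y \<circ> g = g \<circ> x" and yW: "y \<in> carrier W"
    using y unfolding C conj_class_W_iff[OF x] by blast
  obtain b where "orbit_system x (length (cyc_lengths C)) b (\<lambda>i. cyc_lengths C ! i) (\<lambda>i. if i < nu C then - 1 else 1)"
    using nf(6) by blast
  from orbit_system.orbit_system_transport[OF this g(1) yW g(2)]
  interpret y: orbit_system y "length (cyc_lengths C)" "g \<circ> b" "\<lambda>i. cyc_lengths C ! i" "\<lambda>i. if i < nu C then - 1 else 1" .
  have e: "(if i < nu C then - 1 else 1 :: real) = - 1" if "i < nu C" for i using that by simp
  show "card (Lambda (u C)) \<le> card (Lambda y)"
    using card_Lambda_u_le[OF nf(1-3)] y.card_Lambda_ge[OF nf(3) e nf(4)] by (rule order_trans)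
  show "card (Sigma_short (u C)) \<le> card (Sigma_short y)"
    using card_Sigma_u_le[OF nf(1-3)] y.card_Sigma_ge[OF nf(3) e] by (rule order_trans)
qed

section \<open>Complementation by the longest element\<close>

lemma w0_carrier: "w0 \<in> carrier W"
proof -
  have "uminus ` signed_basis = signed_basis" by (auto simp: signed_basis_eq image_Un image_image)
  then show ?thesis by (simp add: W_carrier w0_def linear_uminus)
qed

lemma w0_commute: "linear f \<Longrightarrow> f \<circ> w0 = w0 \<circ> f"
  by (simp add: fun_eq_iff w0_def linear_neg)

lemma w0_w0: "w0 \<circ> w0 = id"
  by (simp add: fun_eq_iff w0_def)

lemma card_Phi_short_pos: "card (Phi_short_pos :: (real, 'n::{finite,linorder}) vec set) = CARD('n)"
proof -
  have eq: "(Phi_short_pos :: (real, 'n) vec set) = evec ` {1..CARD('n)}"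
    unfolding Phi_short_pos_def by auto
  show ?thesis unfolding eq card_image[OF inj_on_evec] by simp
qed

text \<open>The images of a root under \<open>y \<circ> w0\<close> and under \<open>y\<close> are
  opposite and of nonzero height, so each positive long root is inverted by exactly one of the two
  maps.\<close>

lemma card_Lambda_w0:
  fixes y :: "('n::{finite,linorder}) endo"
  assumes y: "y \<in> carrier W"
  shows "card (Lambda (y \<circ> w0)) + card (Lambda y) = CARD('n) * (CARD('n) - 1)"
proof -
  have fin: "finite (long_roots :: (real, 'n) vec set)" by (rule finite_long_roots)
  have "Lambda (y \<circ> w0) \<union> Lambda y = Phi_long_pos" "Lambda (y \<circ> w0) \<inter> Lambda y = {}"
    unfolding Lambda_eq[OF y] Lambda_eq[OF W_comp[OF y w0_carrier]] Phi_long_pos_eq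
    using rho_long_nz[OF long_roots_image[OF y]]
    by (auto simp: w0_def linear_neg[OF W_linear[OF y]] rho_minus linorder_neq_iff)
  moreover have "finite (Lambda (y \<circ> w0))" "finite (Lambda y)"
    unfolding Lambda_eq[OF y] Lambda_eq[OF W_comp[OF y w0_carrier]] using fin by simp_all
  ultimately show ?thesis using card_Un_disjoint card_Phi_long_pos by metis
qed

lemma card_Sigma_w0:
  fixes y :: "('n::{finite,linorder}) endo"
  assumes y: "y \<in> carrier W"
  shows "card (Sigma_short (y \<circ> w0)) + card (Sigma_short y) = CARD('n)"
proof -
  have fin: "finite (signed_basis :: (real, 'n) vec set)" by (rule finite_signed_basis)
  have "Sigma_short (y \<circ> w0) \<union> Sigma_short y = Phi_short_pos" "Sigma_short (y \<circ> w0) \<inter> Sigma_short y = {}"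
    unfolding Sigma_eq[OF y] Sigma_eq[OF W_comp[OF y w0_carrier]] Phi_short_pos_eq
    using rho_nz[OF W_mem[OF y]]
    by (auto simp: w0_def linear_neg[OF W_linear[OF y]] rho_minus linorder_neq_iff)
  moreover have "finite (Sigma_short (y \<circ> w0))" "finite (Sigma_short y)"
    unfolding Sigma_eq[OF y] Sigma_eq[OF W_comp[OF y w0_carrier]] using fin by simp_all
  ultimately show ?thesis using card_Un_disjoint card_Phi_short_pos by metis
qed

section \<open>The subgroup of type \<open>D\<close>\<close>

lemma sign_changes_eq:
  fixes w :: "('n::{finite,linorder}) endo"
  assumes w: "w \<in> carrier W"
  shows "sign_changes w = card (Sigma_short w)"
proof -
  let ?I = "{i \<in> {1..CARD('n)}. \<exists>j \<in> {1..CARD('n)}. w (evec i) = - evec j}"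
  have "(\<exists>j \<in> {1..CARD('n)}. w (evec i) = - evec j) \<longleftrightarrow> rho (w (evec i)) < 0" if i: "i \<in> {1..CARD('n)}" for i
  proof
    assume neg: "rho (w (evec i)) < 0"
    from W_mem[OF w evec_signed_basis[OF i]] show "\<exists>j \<in> {1..CARD('n)}. w (evec i) = - evec j"
    proof (cases rule: signed_basisE)
      case (1 j)
      then have "rho (w (evec i)) > 0" using rho_evec_pos[OF 1(1)] by (simp only: 1(2))
      then show ?thesis using neg by simp
    qed blast
  qed (auto simp: rho_minus rho_evec)
  then have "Sigma_short w = evec ` ?I"
    unfolding Sigma_eq[OF w] by (auto elim!: rho_pos_evec simp: evec_signed_basis rho_evec)
  moreover have "inj_on (evec :: nat \<Rightarrow> (real, 'n) vec) ?I"
    by (rule inj_on_subset[OF inj_on_evec]) auto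
  ultimately show ?thesis by (simp add: sign_changes_def card_image)
qed

text \<open>The parity of the sign changes in multiplicative form: as a product over the positive
  short roots it can be reindexed, which makes it a homomorphism.\<close>

definition sign_of :: "('n::{finite,linorder}) endo \<Rightarrow> real" where
  "sign_of w = (\<Prod>v\<in>Phi_short_pos. sgn (rho (w v)))"

lemma finite_Phi_short_pos: "finite (Phi_short_pos :: (real, 'n::{finite,linorder}) vec set)"
  by (rule finite_subset[OF _ finite_signed_basis]) (auto simp: Phi_short_pos_eq)

lemma sign_of_eq:
  fixes w :: "('n::{finite,linorder}) endo"
  assumes w: "w \<in> carrier W"
  shows "sign_of w = (- 1) ^ sign_changes w"
proof -
  have "sign_of w = (\<Prod>v\<in>Phi_short_pos. if rho (w v) < 0 then - 1 else 1)"
    unfolding sign_of_def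
  proof (rule prod.cong[OF refl])
    fix v :: "(real, 'n) vec" assume "v \<in> Phi_short_pos"
    then have "rho (w v) \<noteq> 0" using rho_nz[OF W_mem[OF w]] by (simp add: Phi_short_pos_eq)
    then show "sgn (rho (w v)) = (if rho (w v) < 0 then - 1 else 1)" by (simp add: sgn_if)
  qed
  also have "\<dots> = (- 1) ^ card (Phi_short_pos \<inter> {v. rho (w v) < 0})"
    by (simp add: prod.If_cases[OF finite_Phi_short_pos])
  also have "Phi_short_pos \<inter> {v. rho (w v) < 0} = Sigma_short w"
    unfolding Sigma_eq[OF w] Phi_short_pos_eq by auto
  finally show ?thesis by (simp add: sign_changes_eq[OF w])
qed

text \<open>Up to sign, \<open>g\<close> permutes the positive short roots. Reindexing the product
  for \<open>f\<close> by this permutation, the correcting signs are exactly the factors of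
  \<open>sign_of g\<close>.\<close>

lemma sign_of_comp:
  fixes f g :: "('n::{finite,linorder}) endo"
  assumes f: "f \<in> carrier W" and g: "g \<in> carrier W"
  shows "sign_of (f \<circ> g) = sign_of f * sign_of g"
proof -
  let ?P = "Phi_short_pos :: (real, 'n) vec set"
  \<comment> \<open>\<open>h v\<close> is whichever of \<open>g v\<close> and \<open>- g v\<close>
    is positive.\<close>
  define h where "h v = sgn (rho (g v)) *\<^sub>R g v" for v
  have s: "sgn (rho (g v)) \<in> {1, - 1}" if "v \<in> ?P" for v
    using rho_nz[OF W_mem[OF g], of v] that by (simp add: Phi_short_pos_eq sgn_if)
  have hP: "h v \<in> ?P" if v: "v \<in> ?P" for v
  proof -
    have "g v \<in> signed_basis" using v W_mem[OF g] by (simp add: Phi_short_pos_eq)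
    moreover have "rho (g v) \<noteq> 0" by (rule rho_nz) fact
    ultimately show ?thesis using s[OF v] by (auto simp: h_def Phi_short_pos_eq rho_scale sgn_if)
  qed
  have "inj_on h ?P"
  proof (rule inj_onI)
    fix v v' assume v: "v \<in> ?P" "v' \<in> ?P" "h v = h v'"
    have "h v = g v \<or> h v = - g v" "h v' = g v' \<or> h v' = - g v'"
      using s[OF v(1)] s[OF v(2)] by (auto simp: h_def)
    then have "g v = g v' \<or> g v = g (- v')"
      using v(3) unfolding linear_neg[OF W_linear[OF g]] by (metis minus_minus)
    then have "v = v' \<or> v = - v'" using W_bij[OF g] by (metis bij_def injD)
    then show "v = v'" using v(1,2) by (auto simp: Phi_short_pos_eq rho_minus)
  qed
  then have "bij_betw h ?P ?P"
    using endo_inj_surj[OF finite_Phi_short_pos _ \<open>inj_on h ?P\<close>] hP by (auto simp: bij_betw_def)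
  then have "sign_of f = (\<Prod>v\<in>?P. sgn (rho (f (h v))))"
    unfolding sign_of_def by (rule prod.reindex_bij_betw[symmetric])
  then have "sign_of f * sign_of g = (\<Prod>v\<in>?P. sgn (rho (f (h v))) * sgn (rho (g v)))"
    by (simp add: sign_of_def prod.distrib)
  also have "\<dots> = sign_of (f \<circ> g)"
    unfolding sign_of_def
  proof (rule prod.cong[OF refl])
    fix v assume "v \<in> ?P"
    then show "sgn (rho (f (h v))) * sgn (rho (g v)) = sgn (rho ((f \<circ> g) v))"
      using s[of v] by (auto simp: h_def linear_neg[OF W_linear[OF f]] rho_minus sgn_minus)
  qed
  finally show ?thesis by simp
qed

lemma even_sign_changes_iff: "w \<in> carrier W \<Longrightarrow> even (sign_changes w) \<longleftrightarrow> sign_of w = 1"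
  by (simp add: sign_of_eq minus_one_power_iff)

lemma sign_of_cases: "w \<in> carrier W \<Longrightarrow> sign_of w \<in> {1, - 1}"
  by (simp add: sign_of_eq minus_one_power_iff)

lemma sign_of_id: "sign_of (id :: ('n::{finite,linorder}) endo) = 1"
  unfolding sign_of_def by (rule prod.neutral) (simp add: Phi_short_pos_eq)

lemma carrier_W_hat: "carrier W_hat = {w \<in> carrier W. sign_of w = 1}"
  unfolding W_hat_def using even_sign_changes_iff by auto

lemma sign_of_inv:
  assumes g: "g \<in> carrier W"
  shows "sign_of (inv\<^bsub>W\<^esub> g) = sign_of g"
proof -
  have "sign_of (inv\<^bsub>W\<^esub> g) * sign_of g = 1"
    using sign_of_comp[of "inv\<^bsub>W\<^esub> g" g] W_inv[OF g] g by (simp add: sign_of_id)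
  then show ?thesis using sign_of_cases[OF g] by auto
qed

lemma subgroup_W_hat: "subgroup (carrier W_hat) W"
  by (rule group.subgroupI[OF group_W])
    (auto simp: carrier_W_hat W_comp sign_of_comp W_inv sign_of_inv W_carrier[of id] linear_id sign_of_id
      intro: exI[of _ id])

text \<open>Inverses in the subgroup agree with those in \<open>W\<close>, so conjugacy in type D is
  intertwining by an element of sign 1.\<close>

lemma conj_class_W_hat_iff:
  fixes x y :: "('n::{finite,linorder}) endo"
  shows "y \<in> conj_class W_hat x \<longleftrightarrow> (\<exists>g \<in> carrier W. sign_of g = 1 \<and> y \<circ> g = g \<circ> x)"
proof -
  have "inv\<^bsub>W_hat\<^esub> g = inv\<^bsub>W\<^esub> g" if "g \<in> carrier W_hat" for g :: "'n endo"
    using group.m_inv_consistent[OF group_W subgroup_W_hat that] by (simp add: W_hat_def)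
  moreover have "f \<otimes>\<^bsub>W_hat\<^esub> g = f \<circ> g" for f g :: "'n endo"
    by (simp add: W_hat_def)
  moreover have "y \<in> conj_class W_hat x \<longleftrightarrow>
      (\<exists>g \<in> carrier W_hat. y = g \<otimes>\<^bsub>W_hat\<^esub> x \<otimes>\<^bsub>W_hat\<^esub> inv\<^bsub>W_hat\<^esub> g)"
    unfolding conj_class_def by blast
  ultimately have "y \<in> conj_class W_hat x \<longleftrightarrow> (\<exists>g \<in> carrier W_hat. y = g \<circ> x \<circ> inv\<^bsub>W\<^esub> g)"
    by simp
  also have "\<dots> \<longleftrightarrow> (\<exists>g \<in> carrier W_hat. y \<circ> g = g \<circ> x)"
  proof (rule bex_cong[OF refl])
    fix g :: "'n endo" assume "g \<in> carrier W_hat"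
    then have "inv\<^bsub>W\<^esub> g \<circ> g = id" "g \<circ> inv\<^bsub>W\<^esub> g = id" using W_inv[of g] by (auto simp: carrier_W_hat)
    then show "y = g \<circ> x \<circ> inv\<^bsub>W\<^esub> g \<longleftrightarrow> y \<circ> g = g \<circ> x" by (metis comp_assoc comp_id)
  qed
  finally show ?thesis by (auto simp: carrier_W_hat)
qed

section \<open>Conjugation by \<open>t\<close>\<close>

lemma t_evec:
  assumes "i \<in> {1..CARD('n)}"
  shows "t (evec i :: (real, 'n::{finite,linorder}) vec) = (if i = CARD('n) then - evec i else evec i)"
proof -
  have c: "is_signed_cycle CARD('n) [- int CARD('n)]" by (simp add: is_signed_cycle_def Suc_le_eq)
  show ?thesis
    using cycle_map_entry[OF c, of 0] cycle_map_other[OF c assms] by (simp add: t_def)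
qed

lemma linear_t: "linear t"
  unfolding t_def by (rule linear_cycle_map)

lemma t_t: "t \<circ> t = (id :: ('n::{finite,linorder}) endo)"
  by (rule linear_eq_evec) (simp_all add: linear_compose linear_t linear_id t_evec linear_neg[OF linear_t])

lemma t_carrier: "t \<in> carrier (W :: (('n::{finite,linorder}) endo) monoid)"
proof -
  have sub: "t v \<in> signed_basis" if "v \<in> signed_basis" for v :: "(real, 'n) vec"
    using that by (elim signed_basisE) (simp_all add: t_evec linear_neg[OF linear_t] evec_signed_basis)
  have "v \<in> t ` signed_basis" if "v \<in> signed_basis" for v :: "(real, 'n) vec"
    using sub[OF that] fun_cong[OF t_t, of v] by (intro image_eqI[of v t "t v"]) auto
  then show ?thesis using sub linear_t by (auto simp: W_carrier)
qed

lemma inv_t: "inv\<^bsub>W\<^esub> t = t"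
  using W_inv[OF t_carrier] t_t by (metis comp_assoc comp_id id_comp)

lemma sign_of_t: "sign_of (t :: ('n::{finite,linorder}) endo) = - 1"
proof -
  have "Sigma_short (t :: 'n endo) = {evec CARD('n)}"
    unfolding Sigma_eq[OF t_carrier]
    by (auto elim!: rho_pos_evec simp: t_evec rho_evec rho_minus evec_signed_basis Suc_le_eq split: if_splits)
  then show ?thesis by (simp add: sign_of_eq[OF t_carrier] sign_changes_eq[OF t_carrier])
qed

text \<open>Only the index n is affected, and in a positive long root it can occur only as the
  larger index, which does not decide the sign. Thus \<open>t\<close> exchanges
  \<open>evec i + evec n\<close> and \<open>evec i - evec n\<close> and fixes the other positive
  long roots.\<close>

lemma t_Phi_long_pos:
  assumes "a \<in> (Phi_long_pos :: (real, 'n::{finite,linorder}) vec set)"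
  shows "t a \<in> Phi_long_pos"
proof -
  obtain i j and s :: real where ij: "1 \<le> i" "i < j" "j \<le> CARD('n)" "s \<in> {1, - 1}" "a = evec i + s *\<^sub>R evec j"
    using assms unfolding Phi_long_pos_def by force
  have "t a = evec i + (if j = CARD('n) then - s else s) *\<^sub>R evec j"
    using ij by (simp add: linear_add[OF linear_t] linear_scale[OF linear_t] t_evec)
  then have "rho (t a) > 0"
    using ij by (auto simp: rho_add rho_minus rho_diff rho_evec split: if_splits)
  then show ?thesis
    using long_roots_image[OF t_carrier, of a] assms by (simp add: Phi_long_pos_eq)
qed

text \<open>Since \<open>t\<close> preserves positivity of long roots, it carries the inversions of
  the conjugate to those of \<open>x\<close>. The short root \<open>evec n\<close> is negated by
  \<open>t\<close>, so the argument concerns the D-length only.\<close>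

lemma card_Lambda_conj_t:
  assumes x: "x \<in> carrier W"
  shows "card (Lambda (t \<circ> x \<circ> t)) = card (Lambda x)"
proof (rule bij_betw_same_card[of t])
  have tt: "t (t a) = a" for a using fun_cong[OF t_t, of a] by simp
  have y: "t \<circ> x \<circ> t \<in> carrier W" using x t_carrier by (intro W_comp)
  have pos: "a \<in> long_roots \<Longrightarrow> rho (t a) > 0 \<longleftrightarrow> rho a > 0" for a
    using t_Phi_long_pos[of a] t_Phi_long_pos[of "t a"] long_roots_image[OF t_carrier, of a] by (auto simp: Phi_long_pos_eq tt)
  have neg: "rho (t a) < 0 \<longleftrightarrow> rho a < 0" if "a \<in> long_roots" for a
    using pos[of "- a"] that by (simp add: linear_neg[OF linear_t] rho_minus)
  have L: "t a \<in> long_roots \<longleftrightarrow> a \<in> long_roots" for a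
    using long_roots_image[OF t_carrier, of a] long_roots_image[OF t_carrier, of "t a"] by (auto simp: tt)
  show "bij_betw t (Lambda (t \<circ> x \<circ> t)) (Lambda x)"
    unfolding Lambda_eq[OF x] Lambda_eq[OF y]
    by (rule bij_betw_byWitness[of _ t])
      (auto simp: tt pos neg L long_roots_image[OF x])
qed

text \<open>Multiplication by the central element \<open>w0\<close> maps C into \<open>C0\<close>,
  so complementing inversion sets turns the minimality of \<open>u C0\<close> into maximality of
  \<open>a\<close> for both lengths. For type D, an element of C is conjugate to \<open>a\<close> by
  an even or an odd element of \<open>W\<close>; in the odd case composing with \<open>t\<close>
  makes it even and replaces \<open>a\<close> by \<open>b\<close>.\<close>

theorem theorem3p6:
  fixes C C0 :: "('n::{finite,linorder}) endo set"
    and w :: "'n endo"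
  assumes "C \<in> conj_classes W"
    and "w \<in> C"
    and "C0 = conj_class W (w \<otimes>\<^bsub>W\<^esub> w0)"
  defines "a \<equiv> u C0 \<otimes>\<^bsub>W\<^esub> w0"
    and "b \<equiv> (inv\<^bsub>W\<^esub> t \<otimes>\<^bsub>W\<^esub> u C0 \<otimes>\<^bsub>W\<^esub> t) \<otimes>\<^bsub>W\<^esub> w0"
  shows "(int (Max (l_B ` C)) =
            int CARD('n) ^ 2 - int (card (Lambda (u C0))) - int (card (Sigma_short (u C0))) \<and>
          is_arg_max l_B (\<lambda>x. x \<in> C) a) \<and>
         ((\<exists>K. K \<subseteq> conj_classes W_hat \<and> C = \<Union>K) \<longrightarrow>
            int (Max (l_D ` C)) =
              int CARD('n) ^ 2 - int CARD('n) - int (card (Lambda (u C0))) \<and>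
            is_arg_max l_D (\<lambda>x. x \<in> C) a \<and>
            is_arg_max l_D (\<lambda>x. x \<in> C) b \<and>
            (\<forall>D \<in> conj_classes W_hat. D \<subseteq> C \<longrightarrow>
               (\<exists>x \<in> {a, b}. is_arg_max l_D (\<lambda>y. y \<in> D) x)) \<and>
            (\<forall>D1 \<in> conj_classes W_hat. \<forall>D2 \<in> conj_classes W_hat.
               D1 \<noteq> D2 \<and> C = D1 \<union> D2 \<longrightarrow>
               (a \<in> D1 \<and> b \<in> D2) \<or> (a \<in> D2 \<and> b \<in> D1)))"
proof -
  obtain x0 where x0: "x0 \<in> carrier W" "C = conj_class W x0"
    using assms(1) by (auto simp: conj_classes_def)
  have memC: "y \<in> C \<longleftrightarrow> y \<in> carrier W \<and> (\<exists>g \<in> carrier W. y \<circ> g = g \<circ> x0)" for y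
    unfolding x0(2) by (rule conj_class_W_iff[OF x0(1)])
  have wW: "w \<in> carrier W" using assms(2) memC by blast
  have conj_trans: "y \<in> C" if z: "z \<in> C" and y: "y \<in> carrier W" and g: "g \<in> carrier W" "y \<circ> g = g \<circ> z" for y z g
  proof -
    obtain h where h: "h \<in> carrier W" "z \<circ> h = h \<circ> x0" using z memC by blast
    have "y \<circ> (g \<circ> h) = (g \<circ> h) \<circ> x0" using g(2) h(2) by (metis comp_assoc)
    then show ?thesis using y W_comp[OF g(1) h(1)] memC by blast
  qed
  have conj_C: "\<exists>g \<in> carrier W. y \<circ> g = g \<circ> z" if y: "y \<in> C" and z: "z \<in> C" for y z
  proof -
    obtain g where g: "g \<in> carrier W" "y \<circ> g = g \<circ> x0" using y memC by blast
    obtain h where h: "h \<in> carrier W" "z \<circ> h = h \<circ> x0" using z memC by blast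
    note i = W_inv[OF h(1)]
    have "y \<circ> (g \<circ> inv\<^bsub>W\<^esub> h) = g \<circ> (x0 \<circ> inv\<^bsub>W\<^esub> h)" using g(2) by (metis comp_assoc)
    also have "x0 \<circ> inv\<^bsub>W\<^esub> h = inv\<^bsub>W\<^esub> h \<circ> z" using h(2) i by (metis comp_assoc comp_id id_comp)
    finally have "y \<circ> (g \<circ> inv\<^bsub>W\<^esub> h) = (g \<circ> inv\<^bsub>W\<^esub> h) \<circ> z" by (simp only: comp_assoc)
    then show ?thesis using W_comp[OF g(1)] i by blast
  qed
  define x where "x = w \<circ> w0"
  have xW: "x \<in> carrier W" unfolding x_def by (rule W_comp[OF wW w0_carrier])
  have C0: "C0 = conj_class W x" using assms(3) by (simp add: x_def)
  have uC0: "u C0 \<in> C0" by (rule conj_class_normal_form(5)[OF xW C0])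
  then obtain g where uW: "u C0 \<in> carrier W" and g: "g \<in> carrier W" "u C0 \<circ> g = g \<circ> x"
    unfolding C0 conj_class_W_iff[OF xW] by blast
  have w0c: "f \<circ> w0 = w0 \<circ> f" if "f \<in> carrier W" for f :: "'n endo"
    using w0_commute[OF W_linear[OF that]] .
  have a: "a = u C0 \<circ> w0" by (simp add: a_def)
  have aW: "a \<in> carrier W" unfolding a by (rule W_comp[OF uW w0_carrier])
  \<comment> \<open>\<open>a\<close> and \<open>w\<close> arise from the conjugate elements
    \<open>u C0\<close> and \<open>x\<close> by the central factor \<open>w0\<close>, whose square
    is the identity.\<close>
  have "a \<circ> g = g \<circ> w"
  proof -
    have "a \<circ> g = (u C0 \<circ> g) \<circ> w0" unfolding a using w0c[OF g(1)] by (simp add: comp_assoc)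
    also have "\<dots> = g \<circ> w \<circ> (w0 \<circ> w0)" unfolding g(2) x_def by (simp only: comp_assoc)
    finally show ?thesis unfolding w0_w0 by simp
  qed
  then have aC: "a \<in> C" using conj_trans[OF assms(2) aW g(1)] by blast
  have b: "b = t \<circ> a \<circ> t"
    unfolding b_def a W_mult inv_t comp_assoc w0c[OF t_carrier] ..
  have bW: "b \<in> carrier W" unfolding b using aW t_carrier by (intro W_comp)
  have bt: "b \<circ> t = t \<circ> a" unfolding b by (simp add: comp_assoc t_t)
  have bC: "b \<in> C" using conj_trans[OF aC bW t_carrier bt] .
  have shift: "y \<circ> w0 \<in> C0" if y: "y \<in> C" for y
  proof -
    have yW: "y \<in> carrier W" using y memC by blast
    obtain h where h: "h \<in> carrier W" "y \<circ> h = h \<circ> w" using conj_C[OF y assms(2)] by blast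
    have "(y \<circ> w0) \<circ> h = h \<circ> x"
      unfolding x_def using h(2) w0c[OF h(1)] by (metis comp_assoc)
    then show ?thesis
      unfolding C0 conj_class_W_iff[OF xW] using h(1) W_comp[OF yW w0_carrier] by blast
  qed
  have Lam: "card (Lambda y) \<le> card (Lambda a)" and Sig: "card (Sigma_short y) \<le> card (Sigma_short a)"
    if y: "y \<in> C" for y
  proof -
    have yW: "y \<in> carrier W" using y memC by blast
    have "card (Lambda (u C0)) \<le> card (Lambda (y \<circ> w0))" "card (Sigma_short (u C0)) \<le> card (Sigma_short (y \<circ> w0))"
      using u_minimal[OF xW C0 shift[OF y]] by auto
    then show "card (Lambda y) \<le> card (Lambda a)" "card (Sigma_short y) \<le> card (Sigma_short a)"
      using card_Lambda_w0[OF yW] card_Sigma_w0[OF yW] card_Lambda_w0[OF uW] card_Sigma_w0[OF uW]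
      unfolding a by linarith+
  qed
  \<comment> \<open>Finiteness of the set of lengths comes from the bound itself, as only finitely
    many natural numbers lie below \<open>f a\<close>.\<close>
  have Max: "Max (f ` C) = f a" if "\<And>y. y \<in> C \<Longrightarrow> f y \<le> f a" for f :: "'n endo \<Rightarrow> nat"
  proof (rule Max_eqI)
    show "finite (f ` C)" using that by (intro finite_subset[of "f ` C" "{..f a}"]) auto
  qed (use that aC in auto)
  have lB: "l_B y \<le> l_B a" and lD: "l_D y \<le> l_D a" if "y \<in> C" for y
    using Lam[OF that] Sig[OF that] by (simp_all add: l_B_def l_D_def)
  have sq: "int (CARD('n) * (CARD('n) - 1)) = int CARD('n) ^ 2 - int CARD('n)"
    by (cases "CARD('n)") (auto simp: power2_eq_square algebra_simps)
  have cL: "int (card (Lambda a)) = int CARD('n) ^ 2 - int CARD('n) - int (card (Lambda (u C0)))"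
    using card_Lambda_w0[OF uW] sq unfolding a by linarith
  have cS: "int (card (Sigma_short a)) = int CARD('n) - int (card (Sigma_short (u C0)))"
    using card_Sigma_w0[OF uW] unfolding a by linarith
  have lDb: "l_D b = l_D a" unfolding b l_D_def by (rule card_Lambda_conj_t[OF aW])
  \<comment> \<open>Any y in D is conjugate to \<open>a\<close> by some h. If h is odd,
    \<open>t \<circ> h\<close> is even and intertwines y with \<open>b\<close>.\<close>
  have W_hat_ab: "a \<in> D \<or> b \<in> D" if D: "D \<in> conj_classes W_hat" "D \<subseteq> C" for D
  proof -
    obtain y where y: "y \<in> carrier W_hat" "D = conj_class W_hat y" using D(1) by (auto simp: conj_classes_def)
    have "y \<in> D" unfolding y(2) conj_class_W_hat_iff
      by (intro bexI[of _ id]) (auto simp: sign_of_id W_carrier linear_id)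
    then obtain h where h: "h \<in> carrier W" "a \<circ> h = h \<circ> y" using conj_C[OF aC] D(2) by blast
    show ?thesis
    proof (cases "sign_of h = 1")
      case True
      then have "a \<in> D" unfolding y(2) conj_class_W_hat_iff using h by blast
      then show ?thesis ..
    next
      case False
      then have "sign_of (t \<circ> h) = 1" using sign_of_cases[OF h(1)] by (simp add: sign_of_comp[OF t_carrier h(1)] sign_of_t)
      moreover have "b \<circ> (t \<circ> h) = (t \<circ> h) \<circ> y" using bt h(2) by (metis comp_assoc)
      ultimately have "b \<in> D" unfolding y(2) conj_class_W_hat_iff using W_comp[OF t_carrier h(1)] by blast
      then show ?thesis ..
    qed
  qed
  have disj: "D1 = D2" if D: "D1 \<in> conj_classes W_hat" "D2 \<in> conj_classes W_hat" and y: "y \<in> D1" "y \<in> D2" for D1 D2 y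
  proof -
    have sub: "E1 \<subseteq> E2" if E: "E1 \<in> conj_classes W_hat" "E2 \<in> conj_classes W_hat" "y \<in> E1" "y \<in> E2" for E1 E2
    proof
      fix v assume v: "v \<in> E1"
      obtain x1 x2 where E12: "E1 = conj_class W_hat x1" "E2 = conj_class W_hat x2" using E by (auto simp: conj_classes_def)
      obtain g1 where g1: "g1 \<in> carrier W" "sign_of g1 = 1" "y \<circ> g1 = g1 \<circ> x1"
        using E(3) unfolding E12 conj_class_W_hat_iff by blast
      obtain g2 where g2: "g2 \<in> carrier W" "sign_of g2 = 1" "y \<circ> g2 = g2 \<circ> x2"
        using E(4) unfolding E12 conj_class_W_hat_iff by blast
      obtain g3 where g3: "g3 \<in> carrier W" "sign_of g3 = 1" "v \<circ> g3 = g3 \<circ> x1"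
        using v unfolding E12 conj_class_W_hat_iff by blast
      note i = W_inv[OF g1(1)]
      \<comment> \<open>The conjugations lead from \<open>x2\<close> to y, on to \<open>x1\<close>,
        and then to v; all three factors are even, hence so is their composite.\<close>
      let ?g = "g3 \<circ> (inv\<^bsub>W\<^esub> g1 \<circ> g2)"
      have ic: "inv\<^bsub>W\<^esub> g1 \<circ> g2 \<in> carrier W" using W_comp i g2(1) by blast
      have x1: "x1 \<circ> inv\<^bsub>W\<^esub> g1 = inv\<^bsub>W\<^esub> g1 \<circ> y" using g1(3) i by (metis comp_assoc comp_id id_comp)
      have "v \<circ> ?g = g3 \<circ> (x1 \<circ> inv\<^bsub>W\<^esub> g1) \<circ> g2" using g3(3) by (metis comp_assoc)
      also have "\<dots> = ?g \<circ> x2" unfolding x1 using g2(3) by (metis comp_assoc)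
      finally have "v \<circ> ?g = ?g \<circ> x2" .
      moreover have "sign_of ?g = 1"
        using g1 g2 g3 i sign_of_inv[OF g1(1)] by (simp add: sign_of_comp[OF g3(1) ic] sign_of_comp[of "inv\<^bsub>W\<^esub> g1"])
      ultimately show "v \<in> E2" unfolding E12 conj_class_W_hat_iff using W_comp[OF g3(1) ic] by blast
    qed
    show ?thesis using sub[OF D y] sub[OF D(2,1) y(2,1)] by blast
  qed
  have part1: "int (Max (l_B ` C)) =
        int CARD('n) ^ 2 - int (card (Lambda (u C0))) - int (card (Sigma_short (u C0)))"
    using cL cS by (simp only: Max[of l_B, OF lB]) (simp add: l_B_def)
  have part2: "int (Max (l_D ` C)) = int CARD('n) ^ 2 - int CARD('n) - int (card (Lambda (u C0)))"
    using cL by (simp only: Max[of l_D, OF lD]) (simp add: l_D_def)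
  have args: "is_arg_max l_B (\<lambda>x. x \<in> C) a" "is_arg_max l_D (\<lambda>x. x \<in> C) a" "is_arg_max l_D (\<lambda>x. x \<in> C) b"
    using lB lD aC bC lDb by (auto simp: is_arg_max_linorder)
  have each: "\<exists>x \<in> {a, b}. is_arg_max l_D (\<lambda>y. y \<in> D) x" if D: "D \<in> conj_classes W_hat" "D \<subseteq> C" for D
    using W_hat_ab[OF D] lD lDb D(2) by (fastforce simp: is_arg_max_linorder)
  \<comment> \<open>Each of the two classes contains \<open>a\<close> or \<open>b\<close>, and
    distinct classes are disjoint, so neither can contain both.\<close>
  have split: "(a \<in> D1 \<and> b \<in> D2) \<or> (a \<in> D2 \<and> b \<in> D1)"
    if D: "D1 \<in> conj_classes W_hat" "D2 \<in> conj_classes W_hat" "D1 \<noteq> D2" "C = D1 \<union> D2" for D1 D2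
    using W_hat_ab[of D1] W_hat_ab[of D2] disj[OF D(1,2)] D aC bC by blast
  show ?thesis using part1 part2 args each split by blast
qed

end
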